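(* Let $\mu\in\mathcal{M}_0$ have support in $\{-2,0,2\}$ and write $\mu(\{0\})=p=1-\mu(\{-2,2\})$. Then $\mu\in\mathcal{M}_0^{UI}$ if and only if $p$ can be written as a base-4 fraction $p=a_0.a_1a_2a_3\ldots$, i.e. $p=\sum_{n\ge0}4^{-n}a_n$, with $a_n\in\{0,1,2,3\}$, where $$a_n\le 2^n-\sum_{i=1}^n2^ia_{n-i}\quad\text{for all } n\ge0,$$ or equivalently, $$\sum_{i\ge0}2^{-i}a_i\le1.$$ Furthermore, the set $\mathcal{S}$ of admissible values of $p$, i.e. the set of all values $\mu(\{0\})$ where $\mu$ ranges over the elements of $\mathcal{M}_0^{UI}$ with support in $\{-2,0,2\}$, is the unique fixed point of the mapping $s$ operating on the closed subsets of $[0,1]$ given by $$A\mapsto\Big[0,\tfrac18\Big]\cup\Big(\tfrac14A+\tfrac18\Big)\cup\Big(\tfrac14A+\tfrac14\Big)\cup\{1\}.$$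
   Context: $(X_n)_{n\ge 0}$ is the simple symmetric random walk on $\mathbb{Z}$: $X_0=0$ and $X_n=\sum_{k=1}^n\xi_k$ with $(\xi_k)$ i.i.d., $\mathbb{P}(\xi_k=1)=\mathbb{P}(\xi_k=-1)=\frac12$. All stopping times are with respect to the natural filtration of $(X_n)$ (no external randomisation). $\mathcal{M}_0$ is the set of all centered probability measures on $\mathbb{Z}$ (finite first moment, mean zero). $\mathcal{M}_0^{UI}$ is the set of probability measures $\mu$ on $\mathbb{Z}$ for which there exists an (a.s. finite) stopping time $\tau$ such that $X_\tau\sim\mu$ and $(X_{n\wedge\tau}:n\ge 0)$ is a uniformly integrable martingale. For $A\subset\mathbb{R}$ and $c,d\in\mathbb{R}$, $cA+d=\{ca+d:a\in A\}$. *)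

theory Defs
  imports "HOL-Probability.Probability" "HOL-Library.Extended_Nat"
begin

text \<open>
  The walk lives on an arbitrary probability space carrying its steps \<open>\<xi> 1, \<xi> 2, \<dots>\<close>
  (\<open>\<xi> 0\<close> is not used). The space may be larger than the one generated by the walk; external
  randomisation is excluded because stopping times refer to the natural filtration.
\<close>

locale simple_symmetric_random_walk = prob_space M for M :: "'a measure" +
  fixes \<xi> :: "nat \<Rightarrow> 'a \<Rightarrow> int"
  assumes indep_steps: "indep_vars (\<lambda>_. count_space UNIV) \<xi> {1..}"
    and prob_up: "\<And>k. k \<ge> 1 \<Longrightarrow> prob {\<omega> \<in> space M. \<xi> k \<omega> = 1} = 1 / 2"
    and prob_down: "\<And>k. k \<ge> 1 \<Longrightarrow> prob {\<omega> \<in> space M. \<xi> k \<omega> = -1} = 1 / 2"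

definition walk :: "(nat \<Rightarrow> 'a \<Rightarrow> int) \<Rightarrow> nat \<Rightarrow> 'a \<Rightarrow> int" where
  "walk \<xi> n \<omega> = (\<Sum>k=1..n. \<xi> k \<omega>)"

text \<open>
  Times are extended naturals since a stopping time need only be almost surely finite;
  the \<open>\<sigma>\<close>-algebra at time \<open>\<infinity>\<close> is generated by the whole process.
\<close>

definition natural_filtration :: "'a measure \<Rightarrow> (nat \<Rightarrow> 'a \<Rightarrow> int) \<Rightarrow> enat \<Rightarrow> 'a measure" where
  "natural_filtration M X t =
     sigma (space M) {X k -` B \<inter> space M | k B. enat k \<le> t}"

text \<open>The value where \<open>\<tau> \<omega> = \<infinity>\<close> is unspecified; below this happens only on a null set.\<close>

definition value_at :: "(nat \<Rightarrow> 'a \<Rightarrow> int) \<Rightarrow> ('a \<Rightarrow> enat) \<Rightarrow> 'a \<Rightarrow> int" where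
  "value_at X \<tau> \<omega> = X (the_enat (\<tau> \<omega>)) \<omega>"

definition stopped :: "(nat \<Rightarrow> 'a \<Rightarrow> int) \<Rightarrow> ('a \<Rightarrow> enat) \<Rightarrow> nat \<Rightarrow> 'a \<Rightarrow> int" where
  "stopped X \<tau> n = value_at X (\<lambda>\<omega>. min (enat n) (\<tau> \<omega>))"

definition martingale :: "'a measure \<Rightarrow> (nat \<Rightarrow> 'a measure) \<Rightarrow> (nat \<Rightarrow> 'a \<Rightarrow> real) \<Rightarrow> bool" where
  "martingale M F Y \<longleftrightarrow>
     filtration (space M) F \<and> (\<forall>n. subalgebra M (F n)) \<and>
     (\<forall>n. Y n \<in> borel_measurable (F n)) \<and> (\<forall>n. integrable M (Y n)) \<and>
     (\<forall>m n. m \<le> n \<longrightarrow> (AE \<omega> in M. real_cond_exp M (F m) (Y n) \<omega> = Y m \<omega>))"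

definition uniformly_integrable :: "'a measure \<Rightarrow> (nat \<Rightarrow> 'a \<Rightarrow> real) \<Rightarrow> bool" where
  "uniformly_integrable M Y \<longleftrightarrow>
     (\<forall>n. integrable M (Y n)) \<and>
     (\<forall>\<epsilon>>0. \<exists>K. \<forall>n. (\<integral>\<omega>. \<bar>Y n \<omega>\<bar> * indicator {\<omega>. \<bar>Y n \<omega>\<bar> > K} \<omega> \<partial>M) \<le> \<epsilon>)"

text \<open>Probability measures on the integers are represented by \<^typ>\<open>int pmf\<close>.\<close>

definition centered_measures :: "int pmf set" where
  "centered_measures =
     {\<mu>. integrable (measure_pmf \<mu>) real_of_int \<and> measure_pmf.expectation \<mu> real_of_int = 0}"

definition UI_embeddable :: "'a measure \<Rightarrow> (nat \<Rightarrow> 'a \<Rightarrow> int) \<Rightarrow> int pmf set" where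
  "UI_embeddable M X =
     {\<mu>. \<exists>\<tau>. stopping_time (natural_filtration M X) \<tau> \<and>
            (AE \<omega> in M. \<tau> \<omega> \<noteq> \<infinity>) \<and>
            distr M (count_space UNIV) (value_at X \<tau>) = measure_pmf \<mu> \<and>
            martingale M (\<lambda>n. natural_filtration M X (enat n))
              (\<lambda>n \<omega>. real_of_int (stopped X \<tau> n \<omega>)) \<and>
            uniformly_integrable M (\<lambda>n \<omega>. real_of_int (stopped X \<tau> n \<omega>))}"

definition admissible_values :: "'a measure \<Rightarrow> (nat \<Rightarrow> 'a \<Rightarrow> int) \<Rightarrow> real set" where
  "admissible_values M X = {pmf \<mu> 0 | \<mu>. \<mu> \<in> UI_embeddable M X \<and> set_pmf \<mu> \<subseteq> {-2, 0, 2}}"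

definition s_map :: "real set \<Rightarrow> real set" where
  "s_map A = {0..1/8} \<union> (\<lambda>a. 1/4 * a + 1/8) ` A \<union> (\<lambda>a. 1/4 * a + 1/4) ` A \<union> {1}"

definition closed_unit_subsets :: "real set set" where
  "closed_unit_subsets = {A. closed A \<and> A \<subseteq> {0..1}}"

end

theory Submission
  imports Defs
begin

text \<open>
  Uniform integrability forces the walk to stay in \<open>{-2..2}\<close> until \<open>\<tau>\<close>, so at an even time at which
  it has not yet stopped the walk sits at 0 and its past is a sequence of excursions, each recorded
  by one sign. A stopping time thus selects, for each \<open>n\<close>, a set of \<open>b n\<close> sign words of length
  \<open>n\<close> at whose end it stops in 0, and no selected word is a prefix of another. Each excursion has
  probability 1/4, so \<open>p = \<Sum> b n / 4 ^ n\<close>, and prefix-freeness amounts to Kraft's inequality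
  \<open>\<Sum> b n / 2 ^ n \<le> 1\<close>; conversely, every such \<open>b\<close> comes from a choice of words. Greedy base-4 digits
  minimise \<open>\<Sum> b n / 2 ^ n\<close> among the expansions of \<open>p\<close>, so they may be used for \<open>b\<close>.
\<close>

subsection \<open>Kraft sums and base-4 expansions\<close>

text \<open>Arbitrary multiplicities \<open>b n\<close> are used instead of digits because they are
  closed under the operations that make up \<open>s\<close>. Words split by their first sign into
  two subtrees; each has half of the Kraft budget and multiplies values by 1/4. A subtree exhausted
  by its root contributes 1/4, one exhausted by the two children of its root contributes 2/16 = 1/8,
  and in both cases the other subtree holds a copy of the whole problem: these are the two affine
  branches. The value 1 is stopping at once. Below 1/8 the budget is no constraint, since digits
  beginning with at most one word of length 2 cost at most 1/4 + 3/8 + 3/16 + ... = 1. Taking a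
  value apart again requires a coefficient large enough to fill a subtree, which an arbitrary
  \<open>b\<close> need not offer; the greedy digits do. Uniqueness of the fixed point has two
  halves of different nature. A bounded set contained in its image consists of Kraft values, because
  an infinite itinerary through the branches spells out a suitable \<open>b\<close>. The reverse
  inclusion rests on contraction, closedness and the point 1, which belongs to every image under
  \<open>s\<close>.\<close>

definition kraft_values :: "real set" where
  "kraft_values = {p. \<exists>b :: nat \<Rightarrow> nat. (\<forall>N. (\<Sum>n\<le>N. real (b n) / 2 ^ n) \<le> 1) \<and>
     (\<lambda>n. real (b n) / 4 ^ n) sums p}"

lemma kraft_valuesI:
  "(\<And>N. (\<Sum>n\<le>N. real (b n) / 2 ^ n) \<le> 1) \<Longrightarrow> (\<lambda>n. real (b n) / 4 ^ n) sums p \<Longrightarrow> p \<in> kraft_values"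
  by (auto simp: kraft_values_def)

lemma summable_nonneg_partial_sums:
  fixes f :: "nat \<Rightarrow> real"
  assumes "\<And>n. f n \<ge> 0" "\<And>N. (\<Sum>n\<le>N. f n) \<le> c"
  shows "summable f" "suminf f \<le> c"
proof -
  have le: "(\<Sum>n<N. f n) \<le> c" for N
  proof -
    have "(\<Sum>n<N. f n) \<le> (\<Sum>n\<le>N. f n)"
      by (rule sum_mono2) (auto simp: assms)
    then show ?thesis using assms(2)[of N] by linarith
  qed
  show "summable f"
    by (rule summableI_nonneg_bounded[of _ c]) (auto simp: assms le)
  then show "suminf f \<le> c" using le by (rule suminf_le_const)
qed

lemma kraft_values_unit: "kraft_values \<subseteq> {0..1}"
proof
  fix p assume "p \<in> kraft_values"
  then obtain b :: "nat \<Rightarrow> nat" where b: "\<And>N. (\<Sum>n\<le>N. real (b n) / 2 ^ n) \<le> 1"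
    and p: "(\<lambda>n. real (b n) / 4 ^ n) sums p"
    by (auto simp: kraft_values_def)
  have "p \<ge> 0" using p by (rule sums_le[OF _ sums_zero, rotated]) auto
  moreover have s: "summable (\<lambda>n. real (b n) / 2 ^ n)" and "(\<Sum>n. real (b n) / 2 ^ n) \<le> 1"
    using summable_nonneg_partial_sums[OF _ b] by auto
  moreover have "p \<le> (\<Sum>n. real (b n) / 2 ^ n)"
    using p summable_sums[OF s]
    by (rule sums_le[rotated]) (auto intro!: divide_left_mono power_mono)
  ultimately show "p \<in> {0..1}" by auto
qed

text \<open>\<open>X n\<close> is Horner's scheme for \<open>4 ^ n\<close> times the partial base-4
  sum. Inserting \<open>x (Suc n) = X (Suc n) - 4 * X n\<close>, the factor 4 against weights 2
  leaves each earlier \<open>X n / 2 ^ n\<close> with coefficient 1 - 2 = -1, so larger earlier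
  truncations lower the Kraft sum.\<close>

lemma sum_halves_base4:
  fixes x X :: "nat \<Rightarrow> real"
  assumes "X 0 = x 0" "\<And>n. X (Suc n) = 4 * X n + x (Suc n)"
  shows "(\<Sum>n\<le>N. x n / 2 ^ n) = X N / 2 ^ N - (\<Sum>n<N. X n / 2 ^ n)"
    and "(\<Sum>n\<le>N. x n / 4 ^ n) = X N / 4 ^ N"
  by (induction N) (simp_all add: assms add_divide_distrib)

definition trunc4 :: "real \<Rightarrow> nat \<Rightarrow> nat" where
  "trunc4 x n = nat \<lfloor>4 ^ n * x\<rfloor>"

text \<open>Place 0 carries the whole integer part, so only later places are bounded by 3. This
  allows arguments above 1, as in \<open>kraft_values_small\<close>.\<close>

definition digit4 :: "real \<Rightarrow> nat \<Rightarrow> nat" where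
  "digit4 x n = (case n of 0 \<Rightarrow> trunc4 x 0 | Suc k \<Rightarrow> trunc4 x (Suc k) - 4 * trunc4 x k)"

lemma trunc4_bounds:
  assumes "x \<ge> 0"
  shows "real (trunc4 x n) \<le> 4 ^ n * x" "4 ^ n * x < real (trunc4 x n) + 1"
  using assms by (auto simp: trunc4_def of_nat_nat)

lemma le_trunc4:
  assumes "real k \<le> 4 ^ n * x"
  shows "k \<le> trunc4 x n"
proof -
  have "int k \<le> \<lfloor>4 ^ n * x\<rfloor>" using assms by (subst le_floor_iff) simp
  then show ?thesis by (simp add: trunc4_def nat_le_iff le_nat_iff)
qed

lemma digit4_0: "real (digit4 x 0) = real (trunc4 x 0)"
  by (simp add: digit4_def)

lemma digit4_Suc:
  assumes "x \<ge> 0"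
  shows "real (trunc4 x (Suc n)) = 4 * real (trunc4 x n) + real (digit4 x (Suc n))"
proof -
  have "4 * trunc4 x n \<le> trunc4 x (Suc n)"
    by (rule le_trunc4) (use trunc4_bounds(1)[OF assms, of n] in simp)
  then show ?thesis by (simp add: digit4_def)
qed

lemma digit4_le_3:
  assumes "x \<ge> 0" "n > 0"
  shows "digit4 x n \<le> 3"
proof -
  obtain k where n: "n = Suc k" using assms(2) by (cases n) auto
  have "real (digit4 x n) < 4"
    using trunc4_bounds(1)[OF assms(1), of n] trunc4_bounds(2)[OF assms(1), of k]
      digit4_Suc[OF assms(1), of k] by (simp add: n)
  then show ?thesis by simp
qed

lemma digit4_sums:
  assumes "x \<ge> 0"
  shows "(\<lambda>n. real (digit4 x n) / 4 ^ n) sums x"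
proof -
  have "(\<lambda>n. real (trunc4 x n) / 4 ^ n) \<longlonglongrightarrow> x"
  proof (rule real_tendsto_sandwich)
    show "\<forall>\<^sub>F n in sequentially. x - (1/4) ^ n \<le> real (trunc4 x n) / 4 ^ n"
    proof (intro always_eventually allI)
      fix n show "x - (1/4) ^ n \<le> real (trunc4 x n) / 4 ^ n"
        using divide_right_mono[OF less_imp_le[OF trunc4_bounds(2)[OF assms, of n]], of "4 ^ n"]
        by (simp add: add_divide_distrib power_one_over)
    qed
    show "\<forall>\<^sub>F n in sequentially. real (trunc4 x n) / 4 ^ n \<le> x"
    proof (intro always_eventually allI)
      fix n show "real (trunc4 x n) / 4 ^ n \<le> x"
        using trunc4_bounds(1)[OF assms, of n] by (simp add: field_simps)
    qed
    have "(\<lambda>n. x - (1/4) ^ n) \<longlonglongrightarrow> x - 0"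
      by (intro tendsto_diff tendsto_const LIMSEQ_power_zero) simp
    then show "(\<lambda>n. x - (1/4) ^ n) \<longlonglongrightarrow> x" by simp
  qed auto
  then show ?thesis
    unfolding sums_def_le
    by (subst sum_halves_base4(2)[of "\<lambda>n. real (trunc4 x n)" "\<lambda>n. real (digit4 x n)",
          OF digit4_0[symmetric] digit4_Suc[OF assms]])
qed

text \<open>The greedy base-4 digits minimise \<open>\<Sum> b n / 2 ^ n\<close> among all expansions of \<open>p\<close>:
  summation by parts expresses this sum by the truncations of \<open>p\<close>, and the greedy truncations
  are the largest ones.\<close>

lemma kraft_values_digit4:
  assumes "p \<in> kraft_values"
  shows "(\<Sum>n\<le>N. real (digit4 p n) / 2 ^ n) \<le> 1"
proof -
  obtain b :: "nat \<Rightarrow> nat" where b: "\<And>N. (\<Sum>n\<le>N. real (b n) / 2 ^ n) \<le> 1"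
    and p: "(\<lambda>n. real (b n) / 4 ^ n) sums p"
    using assms by (auto simp: kraft_values_def)
  have p0: "0 \<le> p" using kraft_values_unit assms by auto
  \<comment> \<open>\<open>B\<close> is for \<open>b\<close> what \<open>trunc4 p\<close> is for the
    greedy digits. As an integer that is at most \<open>4 ^ n * p\<close>, it never exceeds
    \<open>trunc4 p n\<close>.\<close>
  define B where "B n = (\<Sum>i\<le>n. b i * 4 ^ (n - i))" for n
  have B_0: "real (B 0) = real (b 0)" by (simp add: B_def)
  have B_Suc: "real (B (Suc n)) = 4 * real (B n) + real (b (Suc n))" for n
  proof -
    have "(\<Sum>i\<le>n. b i * 4 ^ (Suc n - i)) = (\<Sum>i\<le>n. 4 * (b i * 4 ^ (n - i)))"
      by (rule sum.cong) (auto simp: Suc_diff_le)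
    then show ?thesis by (simp add: B_def sum_distrib_left)
  qed
  have B_sum: "(\<Sum>n\<le>N. real (b n) / 4 ^ n) = real (B N) / 4 ^ N" for N
    using sum_halves_base4(2)[of "\<lambda>n. real (B n)" "\<lambda>n. real (b n)", OF B_0 B_Suc] .
  have B_le: "real (B n) \<le> 4 ^ n * p" for n
  proof -
    have "(\<Sum>i<Suc n. real (b i) / 4 ^ i) \<le> p"
      using sum_le_suminf[OF sums_summable[OF p], of "{..<Suc n}"] sums_unique[OF p] by simp
    then have "real (B n) / 4 ^ n \<le> p" unfolding lessThan_Suc_atMost B_sum .
    then show ?thesis by (simp add: divide_simps mult.commute)
  qed
  have s: "summable (\<lambda>n. real (b n) / 2 ^ n)" and s1: "(\<Sum>n. real (b n) / 2 ^ n) \<le> 1"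
    using summable_nonneg_partial_sums[OF _ b] by auto
  have split4: "p = (\<Sum>n. real (b (n + Suc N)) / 4 ^ (n + Suc N)) + real (B N) / 4 ^ N"
    using suminf_split_initial_segment[OF sums_summable[OF p], of "Suc N"] sums_unique[OF p]
    unfolding lessThan_Suc_atMost B_sum by simp
  have split2: "(\<Sum>n. real (b n) / 2 ^ n) =
      (\<Sum>n. real (b (n + Suc N)) / 2 ^ (n + Suc N)) + (\<Sum>n\<le>N. real (b n) / 2 ^ n)"
    using suminf_split_initial_segment[OF s, of "Suc N"] unfolding lessThan_Suc_atMost by simp
  have sh4: "summable (\<lambda>n. real (b (n + Suc N)) / 4 ^ (n + Suc N))"
    by (rule summable_ignore_initial_segment[OF sums_summable[OF p]])
  have sh2: "summable (\<lambda>n. real (b (n + Suc N)) / 2 ^ (n + Suc N))"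
    by (rule summable_ignore_initial_segment[OF s])
  \<comment> \<open>The greedy partial sum may exceed that of \<open>b\<close>, by at most
    \<open>(trunc4 p N - B N) / 2 ^ N\<close>. This excess is charged to the terms of
    \<open>b\<close> beyond \<open>N\<close>, whose Kraft weight is at least \<open>2 ^ N\<close>
    times their value. Hence the comparison is with the full Kraft sum of \<open>b\<close>.\<close>
  have "2 ^ N * (real (b m) / 4 ^ m) \<le> real (b m) / 2 ^ m" if "m \<ge> N" for m
  proof -
    have 4: "(4::real) ^ m = 2 ^ m * 2 ^ m" by (simp flip: power_mult_distrib)
    have "(2::real) ^ N / 2 ^ m \<le> 1" using that by (simp add: power_increasing)
    then have "real (b m) / 2 ^ m * (2 ^ N / 2 ^ m) \<le> real (b m) / 2 ^ m * 1"
      by (intro mult_left_mono) auto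
    then show ?thesis by (simp add: 4 mult.commute)
  qed
  then have "(\<Sum>n. 2 ^ N * (real (b (n + Suc N)) / 4 ^ (n + Suc N)))
      \<le> (\<Sum>n. real (b (n + Suc N)) / 2 ^ (n + Suc N))"
    by (intro suminf_le[OF _ summable_mult[OF sh4] sh2]) (auto simp del: power_Suc)
  then have "2 ^ N * (p - real (B N) / 4 ^ N) \<le> (\<Sum>n. real (b (n + Suc N)) / 2 ^ (n + Suc N))"
    unfolding suminf_mult[OF sh4] by (subst split4) simp
  moreover have "real (trunc4 p N) / 2 ^ N - real (B N) / 2 ^ N \<le> 2 ^ N * (p - real (B N) / 4 ^ N)"
  proof -
    have "(4::real) ^ N = 2 ^ N * 2 ^ N" by (simp flip: power_mult_distrib)
    then show ?thesis using trunc4_bounds(1)[OF p0, of N] by (simp add: field_simps)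
  qed
  moreover have "(\<Sum>n<N. real (B n) / 2 ^ n) \<le> (\<Sum>n<N. real (trunc4 p n) / 2 ^ n)"
    using le_trunc4[OF B_le] by (intro sum_mono divide_right_mono) auto
  ultimately show ?thesis
    using s1 split2 sum_halves_base4(1)[of "\<lambda>n. real (B n)" "\<lambda>n. real (b n)", OF B_0 B_Suc, of N]
      sum_halves_base4(1)[of "\<lambda>n. real (trunc4 p n)" "\<lambda>n. real (digit4 p n)",
        OF digit4_0[symmetric] digit4_Suc[OF p0], of N]
    by linarith
qed

section \<open>Self-similarity of the set of Kraft values\<close>

lemma sum_halves_shift:
  "(\<Sum>n\<le>Suc N. real (case_nat 0 c n) / 2 ^ n) = (\<Sum>n\<le>N. real (c n) / 2 ^ n) / 2"
  by (subst sum.atMost_Suc_shift) (simp add: sum_divide_distrib mult.commute)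

lemma sums_quarters_shift:
  assumes "(\<lambda>n. real (c n) / 4 ^ n) sums q"
  shows "(\<lambda>n. real (case_nat 0 c n) / 4 ^ n) sums (q / 4)"
proof -
  have "(\<lambda>n. real (case_nat 0 c (Suc n)) / 4 ^ Suc n) sums (q / 4)"
    using sums_divide[OF assms, of 4] by (simp add: mult.commute)
  then show ?thesis by (subst (asm) sums_Suc_iff) simp
qed

text \<open>A leading zero halves the Kraft sum but quarters the value. Hence a budget of 2 before
  the shift, one unit for each subtree below the first sign.\<close>

lemma kraft_values_divide_4:
  assumes "\<And>N. (\<Sum>n\<le>N. real (c n) / 2 ^ n) \<le> 2" "(\<lambda>n. real (c n) / 4 ^ n) sums q"
  shows "q / 4 \<in> kraft_values"
proof (rule kraft_valuesI[OF _ sums_quarters_shift[OF assms(2)]])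
  fix N show "(\<Sum>n\<le>N. real (case_nat 0 c n) / 2 ^ n) \<le> 1"
    using assms(1) by (cases N) (simp_all add: sum_halves_shift del: sum.atMost_Suc)
qed

text \<open>One subtree carries a family for \<open>p\<close>, the other carries \<open>m\<close>
  words at depth \<open>k\<close>. The pairs (1, 0) and (2, 1) for (\<open>m\<close>,
  \<open>k\<close>) produce the summands 1/4 and 1/8 of \<open>s_map\<close>.\<close>

lemma kraft_values_divide_4_add:
  assumes "p \<in> kraft_values" "real m / 2 ^ k \<le> 1"
  shows "(p + real m / 4 ^ k) / 4 \<in> kraft_values"
proof -
  obtain b :: "nat \<Rightarrow> nat" where b: "\<And>N. (\<Sum>n\<le>N. real (b n) / 2 ^ n) \<le> 1"
    and p: "(\<lambda>n. real (b n) / 4 ^ n) sums p"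
    using assms by (auto simp: kraft_values_def)
  define c where "c n = b n + (if n = k then m else 0)" for n
  show ?thesis
  proof (rule kraft_values_divide_4)
    fix N
    have "(\<Sum>n\<le>N. real (c n) / 2 ^ n)
        = (\<Sum>n\<le>N. real (b n) / 2 ^ n) + (\<Sum>n\<le>N. if n = k then real m / 2 ^ k else 0)"
      unfolding c_def sum.distrib[symmetric] by (rule sum.cong) (auto simp: add_divide_distrib)
    then show "(\<Sum>n\<le>N. real (c n) / 2 ^ n) \<le> 2"
      using b[of N] assms(2) by (cases "k \<le> N") (simp_all del: divide_le_eq_1 divide_le_eq_1_pos)
  next
    have "(\<lambda>n. real (c n) / 4 ^ n) = (\<lambda>n. real (b n) / 4 ^ n + (if n = k then real m / 4 ^ k else 0))"
      by (auto simp: c_def add_divide_distrib)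
    then show "(\<lambda>n. real (c n) / 4 ^ n) sums (p + real m / 4 ^ k)"
      using sums_add[OF p sums_single[of k "\<lambda>_. real m / 4 ^ k"]] by simp
  qed
qed

lemma one_in_kraft_values: "1 \<in> kraft_values"
proof (rule kraft_valuesI)
  show "(\<lambda>n. real (if n = 0 then 1 else 0) / 4 ^ n) sums 1"
    using sums_single[of 0 "\<lambda>_. 1::real"] by (rule sums_cong[THEN iffD1, rotated]) auto
qed (simp add: if_distrib[of real] if_distribR if_distrib[of "\<lambda>x. x / _"] cong: if_cong)

lemma zero_in_kraft_values: "0 \<in> kraft_values"
  by (rule kraft_valuesI[where b = "\<lambda>_. 0"]) auto

lemma kraft_values_small:
  assumes "0 \<le> p" "p < 1/8"
  shows "p \<in> kraft_values"
proof -
  \<comment> \<open>The factor 16 allows for two shifts, which divide the Kraft sum by 4. Since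
    \<open>x < 2\<close>, its digits have Kraft sum at most 1 + 3 (1/2 + 1/4 + ...) = 4.\<close>
  define x where "x = 16 * p"
  have x: "0 \<le> x" "x < 2" using assms by (auto simp: x_def)
  have "digit4 x 0 \<le> 1" using trunc4_bounds(1)[OF x(1), of 0] x by (simp add: digit4_def)
  then have "(\<Sum>n\<le>N. real (digit4 x n) / 2 ^ n) \<le> 4 - 3 / 2 ^ N" for N
  proof (induction N)
    case (Suc N)
    have "real (digit4 x (Suc N)) / 2 ^ Suc N \<le> 3 / 2 ^ Suc N"
      using digit4_le_3[OF x(1), of "Suc N"] by (intro divide_right_mono) auto
    then show ?case using Suc by simp
  qed auto
  then have "(\<Sum>n\<le>N. real (digit4 x n) / 2 ^ n) \<le> 4" for N
    by (rule order_trans) auto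
  then have "(\<Sum>n\<le>N. real (case_nat 0 (digit4 x) n) / 2 ^ n) \<le> 2" for N
    by (cases N) (simp_all add: sum_halves_shift del: sum.atMost_Suc)
  then have "x / 4 / 4 \<in> kraft_values"
    by (rule kraft_values_divide_4[OF _ sums_quarters_shift[OF digit4_sums[OF x(1)]]])
  then show ?thesis by (simp add: x_def)
qed

lemma s_map_kraft_values_subset: "s_map kraft_values \<subseteq> kraft_values"
proof
  fix p assume "p \<in> s_map kraft_values"
  \<comment> \<open>The endpoint 1/8 is separate: there \<open>16 * p\<close> has integer part 2 and
    the digit estimate fails, but two words of length 2 give this value directly.\<close>
  then consider "0 \<le> p" "p < 1/8" | "p = 1/8" | a where "a \<in> kraft_values" "p = 1/4 * a + 1/8"
    | a where "a \<in> kraft_values" "p = 1/4 * a + 1/4" | "p = 1"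
    unfolding s_map_def by fastforce
  then show "p \<in> kraft_values"
  proof cases
    case 1 then show ?thesis by (rule kraft_values_small)
  next
    case 2
    then have "p = (0 + real 2 / 4 ^ 1) / 4" by simp
    show ?thesis unfolding \<open>p = (0 + real 2 / 4 ^ 1) / 4\<close>
      by (rule kraft_values_divide_4_add[OF zero_in_kraft_values]) simp
  next
    case 3 then show ?thesis using kraft_values_divide_4_add[of _ 2 1] by (simp add: add_divide_distrib)
  next
    case 4 then show ?thesis using kraft_values_divide_4_add[of _ 1 0] by (simp add: add_divide_distrib)
  next
    case 5 then show ?thesis using one_in_kraft_values by simp
  qed
qed

text \<open>This undoes \<open>kraft_values_divide_4_add\<close>. The \<open>m = 2 ^ k\<close>
  removed words use half of the budget; dropping the leading zero doubles the Kraft sum, so at most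
  2 - 1 = 1 remains.\<close>

lemma kraft_values_remove:
  fixes d :: "nat \<Rightarrow> nat"
  assumes kraft: "\<And>N. (\<Sum>n\<le>N. real (d n) / 2 ^ n) \<le> 1" and sums: "(\<lambda>n. real (d n) / 4 ^ n) sums p"
    and d0: "d 0 = 0" and m: "m \<le> d (Suc k)" "real m / 2 ^ k = 1"
  shows "4 * p - real m / 4 ^ k \<in> kraft_values"
proof -
  define c where "c n = d (Suc n) - (if n = k then m else 0)" for n
  have c: "real (c n) / x = real (d (Suc n)) / x - (if n = k then real m / x else 0)" for n x
    using m(1) by (auto simp: c_def diff_divide_distrib of_nat_diff)
  show ?thesis
  proof (rule kraft_valuesI)
    fix N
    \<comment> \<open>For \<open>N < k\<close> the removed term would lie outside the partial sum
      and only the bound 2 would result; the longer sum always contains index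
      \<open>k\<close>.\<close>
    define L where "L = max N k"
    have "(\<Sum>n\<le>N. real (c n) / 2 ^ n) \<le> (\<Sum>n\<le>L. real (c n) / 2 ^ n)"
      by (rule sum_mono2) (auto simp: L_def)
    also have "\<dots> = (\<Sum>n\<le>L. real (d (Suc n)) / 2 ^ n) - (\<Sum>n\<le>L. if n = k then real m / 2 ^ n else 0)"
      unfolding sum_subtractf[symmetric] by (rule sum.cong) (auto simp: c)
    also have "(\<Sum>n\<le>L. if n = k then real m / 2 ^ n else 0) = 1"
      using m(2) by (simp add: L_def)
    also have "(\<Sum>n\<le>L. real (d (Suc n)) / 2 ^ n) = 2 * (\<Sum>n\<le>Suc L. real (d n) / 2 ^ n)"
      by (subst sum.atMost_Suc_shift) (simp add: d0 sum_distrib_left)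
    finally show "(\<Sum>n\<le>N. real (c n) / 2 ^ n) \<le> 1" using kraft[of "Suc L"] by linarith
  next
    have "(\<lambda>n. real (d (Suc n)) / 4 ^ Suc n) sums p"
      using sums by (subst sums_Suc_iff) (simp add: d0)
    then have "(\<lambda>n. 4 * (real (d (Suc n)) / 4 ^ Suc n)) sums (4 * p)" by (rule sums_mult)
    then have "(\<lambda>n. real (d (Suc n)) / 4 ^ n) sums (4 * p)" by simp
    from sums_diff[OF this sums_single[of k "\<lambda>n. real m / 4 ^ n"]]
    show "(\<lambda>n. real (c n) / 4 ^ n) sums (4 * p - real m / 4 ^ k)" by (simp add: c)
  qed
qed

lemma kraft_values_subset_s_map: "kraft_values \<subseteq> s_map kraft_values"
proof
  fix p assume p: "p \<in> kraft_values"
  define d where "d = digit4 p"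
  have p01: "0 \<le> p" "p \<le> 1" using p kraft_values_unit by auto
  have kraft: "(\<Sum>n\<le>N. real (d n) / 2 ^ n) \<le> 1" for N
    unfolding d_def by (rule kraft_values_digit4[OF p])
  have sums: "(\<lambda>n. real (d n) / 4 ^ n) sums p" unfolding d_def by (rule digit4_sums[OF p01(1)])
  have d3: "d n \<le> 3" if "n > 0" for n unfolding d_def by (rule digit4_le_3[OF p01(1) that])
  \<comment> \<open>If the digits offer neither a word of length 1 nor two words of length 2, then
    \<open>p\<close> is at most 1/16 + 3/64 + 3/256 + ... = 1/8.\<close>
  consider "d 0 \<ge> 1" | "d 0 = 0" "d 1 \<ge> 1" | "d 0 = 0" "d 2 \<ge> 2" | "d 0 = 0" "d 1 = 0" "d 2 \<le> 1"
    by linarith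
  then show "p \<in> s_map kraft_values"
  proof cases
    case 1
    have "real (d 0) / 4 ^ 0 \<le> p"
      using sum_le_suminf[OF sums_summable[OF sums], of "{0}"] sums_unique[OF sums] by simp
    then have "p = 1" using 1 p01 by simp
    then show ?thesis by (simp add: s_map_def)
  next
    case 2
    have "4 * p - 1 \<in> kraft_values"
      using kraft_values_remove[OF kraft sums 2(1), of 1 0] 2 by simp
    then have "1/4 * (4 * p - 1) + 1/4 \<in> s_map kraft_values" unfolding s_map_def by blast
    then show ?thesis by (simp add: diff_divide_distrib)
  next
    case 3
    have "4 * p - 1/2 \<in> kraft_values"
      using kraft_values_remove[OF kraft sums 3(1), of 2 1] 3 by (simp add: numeral_2_eq_2)
    then have "1/4 * (4 * p - 1/2) + 1/8 \<in> s_map kraft_values" unfolding s_map_def by blast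
    then show ?thesis by (simp add: diff_divide_distrib)
  next
    case 4
    have *: "(\<Sum>n\<le>N + 2. real (d n) / 4 ^ n) \<le> 1/8 - 1 / 4 ^ (N + 2)" for N
    proof (induction N)
      case 0
      have "real (d 2) \<le> 1" using 4 by simp
      then show ?case using 4 by (simp add: numeral_2_eq_2)
    next
      case (Suc N)
      have "real (d (Suc N + 2)) / 4 ^ (Suc N + 2) \<le> 3 / 4 ^ (Suc N + 2)"
        using d3[of "Suc N + 2"] by (intro divide_right_mono) auto
      then show ?case using Suc by simp
    qed
    have "(\<Sum>n\<le>N + 2. real (d n) / 4 ^ n) \<le> 1/8" for N
      by (rule order_trans[OF *]) simp
    moreover have "(\<lambda>N. \<Sum>n\<le>N + 2. real (d n) / 4 ^ n) \<longlonglongrightarrow> p"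
      using sums unfolding sums_def_le by (rule LIMSEQ_ignore_initial_segment)
    ultimately have "p \<le> 1/8" by (intro LIMSEQ_le_const2) auto
    then show ?thesis using p01 by (auto simp: s_map_def)
  qed
qed

lemma s_map_kraft_values: "s_map kraft_values = kraft_values"
  using s_map_kraft_values_subset kraft_values_subset_s_map by blast

subsection \<open>The fixed point of the map \<open>s\<close>\<close>

lemma s_map_mono: "A \<subseteq> B \<Longrightarrow> s_map A \<subseteq> s_map B"
  unfolding s_map_def by blast

lemma s_map_cases:
  assumes "p \<in> s_map A"
  obtains "p \<in> {0..1/8} \<union> {1}"
    | q c where "q \<in> A" "c \<in> {1, 2}" "p = q / 4 + real c / 8"
proof -
  consider "p \<in> {0..1/8} \<union> {1}" | q where "q \<in> A" "p = q / 4 + real 1 / 8"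
    | q where "q \<in> A" "p = q / 4 + real 2 / 8"
    using assms unfolding s_map_def by auto
  then show thesis using that by cases blast+
qed

text \<open>A point of \<open>A\<close> outside \<open>kraft_values\<close> has a preimage of the
  same kind under one of the branches, hence an infinite itinerary \<open>e\<close>. Branch 2 at
  step \<open>n\<close> is read as one word of length \<open>n + 1\<close>, branch 1 as two words of
  length \<open>n + 2\<close>. Either costs \<open>1 / 2 ^ (n + 1)\<close>, so the itinerary
  exhausts the budget exactly, and boundedness of \<open>A\<close> makes the remainders
  vanish.\<close>

lemma kraft_values_coinduct:
  assumes unit: "A \<subseteq> {0..1}" and sub: "A \<subseteq> s_map A"
  shows "A \<subseteq> kraft_values"
proof (rule ccontr)
  assume "\<not> A \<subseteq> kraft_values"
  then obtain p where p: "p \<in> A - kraft_values" by blast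
  have "\<exists>q c. q \<in> A - kraft_values \<and> c \<in> {1, 2} \<and> x = q / 4 + real c / 8"
    if x: "x \<in> A - kraft_values" for x
  proof -
    have notbase: "x \<notin> s_map kraft_values" using x s_map_kraft_values_subset by blast
    have "x \<in> s_map A" using x sub by blast
    then show ?thesis
    proof (cases rule: s_map_cases)
      case 1 then show ?thesis using notbase by (auto simp: s_map_def)
    next
      case (2 q c)
      have "q \<notin> kraft_values"
      proof
        assume "q \<in> kraft_values"
        then have "1/4 * q + 1/8 \<in> s_map kraft_values" "1/4 * q + 1/4 \<in> s_map kraft_values"
          unfolding s_map_def by blast+
        then show False using notbase 2 by auto
      qed
      then show ?thesis using 2 by blast
    qed
  qed
  then obtain g c where gc: "\<And>x. x \<in> A - kraft_values \<Longrightarrow>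
      g x \<in> A - kraft_values \<and> c x \<in> {1, 2} \<and> x = g x / 4 + real (c x) / 8"
    by metis
  define y where "y n = (g ^^ n) p" for n
  define e where "e n = c (y n)" for n
  have y: "y n \<in> A - kraft_values" for n
    by (induction n) (use p gc in \<open>auto simp: y_def\<close>)
  have e: "e n \<in> {1, 2}" "y n = y (Suc n) / 4 + real (e n) / 8" for n
    using gc[OF y[of n]] by (auto simp: e_def y_def)
  \<comment> \<open>Branch 2 taken at step \<open>n - 1\<close> and branch 1 taken at step
    \<open>n - 2\<close> both produce words of length \<open>n\<close>; the guards keep the natural
    subtraction from truncating.\<close>
  define b where "b n = (if n \<ge> 1 \<and> e (n - 1) = 2 then 1 else 0)
      + (if n \<ge> 2 \<and> e (n - 2) = 1 then 2 else (0::nat))" for n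
  have b_0: "b 0 = 0" and b_1: "b (Suc 0) = (if e 0 = 2 then 1 else 0)"
    and b_Suc: "b (Suc (Suc n)) = (if e (Suc n) = 2 then 1 else 0) + (if e n = 1 then 2 else 0)" for n
    by (auto simp: b_def)
  have "(\<Sum>n\<le>N. real (b n) / 2 ^ n) \<le> 1" for N
  proof -
    \<comment> \<open>Steps 0 to \<open>N\<close> cost \<open>1 - 1 / 2 ^ Suc N\<close> together. If
      \<open>e N = 1\<close>, the last two words have length \<open>N + 2\<close> and are not yet
      counted, hence the correction.\<close>
    have "(\<Sum>n\<le>Suc N. real (b n) / 2 ^ n) = 1 - 1 / 2 ^ Suc N - (if e N = 1 then 1 / 2 ^ Suc N else 0)"
    proof (induction N)
      case (Suc N)
      show ?case unfolding sum.atMost_Suc[of _ "Suc N"] Suc using e(1)[of N] e(1)[of "Suc N"]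
        by (auto simp: b_Suc)
    qed (use e(1)[of 0] in \<open>auto simp: b_0 b_1\<close>)
    moreover have "1 / 2 ^ Suc N + (if e N = 1 then 1 / 2 ^ Suc N else 0) \<ge> (0::real)" by simp
    ultimately have "(\<Sum>n\<le>Suc N. real (b n) / 2 ^ n) \<le> 1" by linarith
    moreover have "(\<Sum>n\<le>N. real (b n) / 2 ^ n) \<le> (\<Sum>n\<le>Suc N. real (b n) / 2 ^ n)" by simp
    ultimately show ?thesis by linarith
  qed
  moreover have "(\<lambda>n. real (b n) / 4 ^ n) sums p"
  proof -
    \<comment> \<open>The 1/2 is again the delayed contribution of \<open>e N = 1\<close>, as
      \<open>2 / 4 ^ (N + 2) = (1/2) / 4 ^ Suc N\<close>.\<close>
    have eq: "(\<Sum>n\<le>Suc N. real (b n) / 4 ^ n) = p - (y (Suc N) + (if e N = 1 then 1/2 else 0)) / 4 ^ Suc N" for N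
    proof (induction N)
      case 0
      have "p = y (Suc 0) / 4 + real (e 0) / 8" using e(2)[of 0] by (simp add: y_def)
      then show ?case using e(1)[of 0] by (auto simp: b_0 b_1)
    next
      case (Suc N)
      show ?case unfolding sum.atMost_Suc[of _ "Suc N"] Suc using e[of "Suc N"] e(1)[of N]
        by (auto simp: b_Suc add_divide_distrib)
    qed
    have "(\<lambda>N. (y (Suc N) + (if e N = 1 then 1/2 else 0)) / 4 ^ Suc N) \<longlonglongrightarrow> 0"
    proof (rule real_tendsto_sandwich)
      have y01: "0 \<le> y n \<and> y n \<le> 1" for n using y[of n] unit by auto
      show "\<forall>\<^sub>F N in sequentially. 0 \<le> (y (Suc N) + (if e N = 1 then 1/2 else 0)) / 4 ^ Suc N"
        using y01 by (intro always_eventually allI) (auto intro!: divide_nonneg_pos add_nonneg_nonneg)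
      show "\<forall>\<^sub>F N in sequentially. (y (Suc N) + (if e N = 1 then 1/2 else 0)) / 4 ^ Suc N \<le> 2 / 4 * (1/4) ^ N"
      proof (intro always_eventually allI)
        fix N
        have "y (Suc N) + (if e N = 1 then 1/2 else 0) \<le> 2"
          using y01[of "Suc N"] by auto
        then have "(y (Suc N) + (if e N = 1 then 1/2 else 0)) / 4 ^ Suc N \<le> 2 / 4 ^ Suc N"
          by (rule divide_right_mono) simp
        then show "(y (Suc N) + (if e N = 1 then 1/2 else 0)) / 4 ^ Suc N \<le> 2 / 4 * (1/4) ^ N"
          by (simp add: power_one_over)
      qed
      have "(\<lambda>N. 2 / 4 * (1/4) ^ N :: real) \<longlonglongrightarrow> 2 / 4 * 0"
        by (intro tendsto_mult tendsto_const LIMSEQ_power_zero) simp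
      then show "(\<lambda>N. 2 / 4 * (1/4) ^ N :: real) \<longlonglongrightarrow> 0" by simp
    qed auto
    then have "(\<lambda>N. \<Sum>n\<le>Suc N. real (b n) / 4 ^ n) \<longlonglongrightarrow> p - 0"
      unfolding eq by (intro tendsto_diff tendsto_const)
    then have "(\<lambda>N. \<Sum>n\<le>Suc N. real (b n) / 4 ^ n) \<longlonglongrightarrow> p" by (simp only: diff_zero)
    then show ?thesis unfolding sums_def_le by (rule LIMSEQ_imp_Suc)
  qed
  ultimately have "p \<in> kraft_values" by (rule kraft_valuesI)
  then show False using p by simp
qed

lemma s_map_closed_unit_subsets: "A \<in> closed_unit_subsets \<Longrightarrow> s_map A \<in> closed_unit_subsets"
proof -
  assume A: "A \<in> closed_unit_subsets"
  have "closed ((\<lambda>a. 1/4 * a + c) ` A)" for c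
  proof -
    have "closed ((+) c ` (\<lambda>a. (1/4) *\<^sub>R a) ` A)"
      using A by (intro closed_translation closed_scaling) (simp add: closed_unit_subsets_def)
    then show ?thesis by (simp add: image_image add.commute)
  qed
  moreover have "s_map A \<subseteq> s_map {0..1}"
    using A by (intro s_map_mono) (simp add: closed_unit_subsets_def)
  moreover have "s_map {0..1} \<subseteq> {0..1}" by (auto simp: s_map_def)
  ultimately show "s_map A \<in> closed_unit_subsets"
    unfolding closed_unit_subsets_def s_map_def
    by (intro CollectI conjI closed_Un closed_singleton closed_atLeastAtMost) auto
qed

text \<open>Both branches are injective, so \<open>4 * p - 1/2\<close> and \<open>4 * p - 1\<close>
  are the only possible preimages of \<open>p\<close>. If each leaves the decreasing sequence at
  some index, both are gone at the larger one.\<close>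

lemma INT_s_map_subset:
  assumes "decseq K"
  shows "(\<Inter>n. s_map (K n)) \<subseteq> s_map (\<Inter>n. K n)"
proof
  fix p assume p: "p \<in> (\<Inter>n. s_map (K n))"
  show "p \<in> s_map (\<Inter>n. K n)"
  proof (rule ccontr)
    assume np: "p \<notin> s_map (\<Inter>n. K n)"
    have "4 * p - 1/2 \<notin> (\<Inter>n. K n)" "4 * p - 1 \<notin> (\<Inter>n. K n)"
    proof -
      have "p = 1/4 * (4 * p - 1/2) + 1/8" "p = 1/4 * (4 * p - 1) + 1/4"
        by (simp_all add: diff_divide_distrib)
      then show "4 * p - 1/2 \<notin> (\<Inter>n. K n)" "4 * p - 1 \<notin> (\<Inter>n. K n)"
        using np unfolding s_map_def by blast+
    qed
    then obtain m n where "4 * p - 1/2 \<notin> K m" "4 * p - 1 \<notin> K n" by auto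
    moreover have "K (max m n) \<subseteq> K m" "K (max m n) \<subseteq> K n"
      using assms by (auto simp: decseq_def)
    ultimately have "4 * p - 1/2 \<notin> K (max m n)" "4 * p - 1 \<notin> K (max m n)" by auto
    moreover have "p \<in> s_map (K (max m n))" using p by blast
    ultimately show False using np unfolding s_map_def by auto
  qed
qed

text \<open>Closedness comes from writing the set as the intersection of the iterates of
  \<open>s_map\<close> on the unit interval. That intersection is contained in its own image, so
  coinduction bounds it from above.\<close>

lemma kraft_values_closed_unit_subsets: "kraft_values \<in> closed_unit_subsets"
proof -
  define K where "K n = (s_map ^^ n) {0..1}" for n
  have K_Suc: "K (Suc n) = s_map (K n)" for n by (simp add: K_def)
  have K: "K n \<in> closed_unit_subsets" for n
    by (induction n) (auto simp: K_Suc s_map_closed_unit_subsets, simp add: K_def closed_unit_subsets_def)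
  have dec: "K (Suc n) \<subseteq> K n" for n
  proof (induction n)
    case 0
    then show ?case using K[of 1] by (simp add: closed_unit_subsets_def K_def)
  next
    case (Suc n)
    then show ?case unfolding K_Suc by (rule s_map_mono)
  qed
  then have "decseq K" by (rule decseq_SucI)
  have "kraft_values = (\<Inter>n. K n)"
  proof
    have "kraft_values \<subseteq> K n" for n
    proof (induction n)
      case 0
      then show ?case using kraft_values_unit by (simp add: K_def)
    next
      case (Suc n)
      then show ?case using s_map_mono[OF Suc] by (simp add: K_Suc s_map_kraft_values)
    qed
    then show "kraft_values \<subseteq> (\<Inter>n. K n)" by blast
    show "(\<Inter>n. K n) \<subseteq> kraft_values"
    proof (rule kraft_values_coinduct)
      show "(\<Inter>n. K n) \<subseteq> {0..1}" using K by (auto simp: closed_unit_subsets_def)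
      have "(\<Inter>n. K n) \<subseteq> (\<Inter>n. s_map (K n))" unfolding K_Suc[symmetric] by (intro INT_greatest INT_lower) simp
      then show "(\<Inter>n. K n) \<subseteq> s_map (\<Inter>n. K n)" 
        using INT_s_map_subset[OF \<open>decseq K\<close>] by (rule subset_trans)
    qed
  qed
  moreover have "closed (\<Inter>n. K n)" using K by (intro closed_INT) (simp add: closed_unit_subsets_def)
  ultimately show ?thesis using kraft_values_unit by (simp add: closed_unit_subsets_def)
qed

text \<open>Coinduction puts \<open>A\<close> inside \<open>kraft_values\<close>. Conversely, the
  branches contract by 1/4, so following a point of \<open>kraft_values\<close> through
  \<open>k\<close> branches yields a point of \<open>A\<close> at distance at most
  \<open>(1/4) ^ k\<close>, and \<open>A\<close> is closed.\<close>

lemma s_map_fixed_point_unique: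
  assumes A: "A \<in> closed_unit_subsets" "s_map A = A"
  shows "A = kraft_values"
proof
  show "A \<subseteq> kraft_values"
    using A by (intro kraft_values_coinduct) (auto simp: closed_unit_subsets_def)
  have near: "\<forall>p\<in>kraft_values. \<exists>q\<in>A. \<bar>q - p\<bar> \<le> (1/4) ^ k" for k
  proof (induction k)
    case 0
    \<comment> \<open>The isolated point 1 in \<open>s_map\<close> makes \<open>A\<close> nonempty
      and starts the approximation at distance at most 1.\<close>
    have "1 \<in> A" using A(2) by (auto simp: s_map_def)
    then show ?case using kraft_values_unit by (intro ballI bexI[of _ 1]) auto
  next
    case (Suc k)
    show ?case
    proof
      fix p assume "p \<in> kraft_values"
      then have "p \<in> s_map kraft_values" by (simp add: s_map_kraft_values)
      then show "\<exists>q\<in>A. \<bar>q - p\<bar> \<le> (1/4) ^ Suc k"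
      proof (cases rule: s_map_cases)
        case 1
        then have "p \<in> A" using A(2) by (auto simp: s_map_def)
        then show ?thesis by (intro bexI[of _ p]) auto
      next
        case (2 p' c)
        then obtain q where q: "q \<in> A" "\<bar>q - p'\<bar> \<le> (1/4) ^ k" using Suc by blast
        have "1/4 * q + 1/8 \<in> s_map A" "1/4 * q + 1/4 \<in> s_map A"
          using q unfolding s_map_def by blast+
        then have "q / 4 + 1 / 8 \<in> A" "q / 4 + 1 / 4 \<in> A" unfolding A(2) by simp_all
        then have "q / 4 + real c / 8 \<in> A" using 2(2) by auto
        then show ?thesis
          by (rule bexI[rotated]) (use q 2(3) in \<open>simp flip: diff_divide_distrib\<close>)
      qed
    qed
  qed
  show "kraft_values \<subseteq> A"
  proof
    fix p assume p: "p \<in> kraft_values"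
    have "\<exists>q\<in>A. dist q p < \<epsilon>" if "\<epsilon> > 0" for \<epsilon>
    proof -
      obtain k where "(1/4) ^ k < \<epsilon>" using real_arch_pow_inv[OF \<open>\<epsilon> > 0\<close>, of "1/4"] by auto
      then show ?thesis using near[of k] p by (force simp: dist_real_def)
    qed
    then show "p \<in> A"
      using A(1) closed_approachable[of A p] by (simp add: closed_unit_subsets_def)
  qed
qed

section \<open>Translation into digit conditions\<close>

text \<open>Multiplication by \<open>2 ^ n\<close> clears denominators; \<open>a n\<close> is the
  missing term \<open>i = 0\<close> of the reversed sum.\<close>

lemma kraft_partial_sums_int_iff:
  fixes a :: "nat \<Rightarrow> int"
  shows "a n \<le> 2 ^ n - (\<Sum>i=1..n. 2 ^ i * a (n - i)) \<longleftrightarrow> (\<Sum>i\<le>n. real_of_int (a i) / 2 ^ i) \<le> 1"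
proof -
  have pow2: "(2::real) ^ (n - i) = 2 ^ n / 2 ^ i" if "i \<le> n" for i
    using that by (simp add: power_diff)
  have "(\<Sum>i=1..n. 2 ^ i * a (n - i)) + a n = (\<Sum>i\<le>n. 2 ^ i * a (n - i))"
    by (simp add: atMost_atLeast0 sum.atLeast_Suc_atMost[of 0 n])
  also have "\<dots> = (\<Sum>i\<le>n. 2 ^ (n - i) * a i)"
    by (rule sum.reindex_bij_witness[of _ "\<lambda>i. n - i" "\<lambda>i. n - i"]) auto
  finally have "a n \<le> 2 ^ n - (\<Sum>i=1..n. 2 ^ i * a (n - i)) \<longleftrightarrow> (\<Sum>i\<le>n. 2 ^ (n - i) * a i) \<le> 2 ^ n"
    by linarith
  also have "\<dots> \<longleftrightarrow> real_of_int (\<Sum>i\<le>n. 2 ^ (n - i) * a i) \<le> real_of_int (2 ^ n)"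
    by (rule of_int_le_iff[symmetric])
  also have "real_of_int (\<Sum>i\<le>n. 2 ^ (n - i) * a i) = 2 ^ n * (\<Sum>i\<le>n. real_of_int (a i) / 2 ^ i)"
    unfolding sum_distrib_left of_int_sum
    by (rule sum.cong) (auto simp: pow2)
  also have "2 ^ n * (\<Sum>i\<le>n. real_of_int (a i) / 2 ^ i) \<le> real_of_int (2 ^ n) \<longleftrightarrow>
      (\<Sum>i\<le>n. real_of_int (a i) / 2 ^ i) \<le> 1"
    by simp
  finally show ?thesis .
qed

lemma kraft_values_int_digits_iff:
  "p \<in> kraft_values \<longleftrightarrow> (\<exists>a :: nat \<Rightarrow> int. (\<forall>n. a n \<in> {0, 1, 2, 3}) \<and>
     (\<lambda>n. real_of_int (a n) / 4 ^ n) sums p \<and>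
     (\<forall>n. a n \<le> 2 ^ n - (\<Sum>i=1..n. 2 ^ i * a (n - i))))" (is "_ \<longleftrightarrow> ?R")
proof
  assume p: "p \<in> kraft_values"
  then have p01: "0 \<le> p" "p \<le> 1" using kraft_values_unit by auto
  have d3: "digit4 p n \<le> 3" for n
  proof (cases n)
    case 0
    then show ?thesis using trunc4_bounds(1)[OF p01(1), of 0] p01(2) by (simp add: digit4_def)
  qed (use digit4_le_3[OF p01(1)] in auto)
  have "int (digit4 p n) \<in> {0, 1, 2, 3}" for n
    using d3[of n] by auto
  then show ?R
    using kraft_values_digit4[OF p] digit4_sums[OF p01(1)]
    by (intro exI[of _ "\<lambda>n. int (digit4 p n)"] conjI allI kraft_partial_sums_int_iff[THEN iffD2])
      (simp_all only: of_int_of_nat_eq)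
next
  assume ?R
  then obtain a :: "nat \<Rightarrow> int" where a: "\<And>n. a n \<in> {0, 1, 2, 3}"
    "(\<lambda>n. real_of_int (a n) / 4 ^ n) sums p"
    "\<And>N. (\<Sum>n\<le>N. real_of_int (a n) / 2 ^ n) \<le> 1"
    unfolding kraft_partial_sums_int_iff by blast
  have "real_of_int (a n) = real (nat (a n))" for n using a(1)[of n] by auto
  then show "p \<in> kraft_values"
    using a(2,3) by (intro kraft_valuesI[of "\<lambda>n. nat (a n)"]) simp_all
qed

lemma kraft_partial_sums_suminf_iff:
  fixes a :: "nat \<Rightarrow> int"
  assumes "\<forall>n. a n \<in> {0, 1, 2, 3}"
  shows "(\<forall>n. a n \<le> 2 ^ n - (\<Sum>i=1..n. 2 ^ i * a (n - i))) \<longleftrightarrow> (\<Sum>i. real_of_int (a i) / 2 ^ i) \<le> 1"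
proof -
  have nn: "real_of_int (a i) / 2 ^ i \<ge> 0" for i using assms[rule_format, of i] by auto
  \<comment> \<open>The value of \<open>suminf\<close> is meaningful only for a summable series;
    digits of at most 3 provide a geometric majorant.\<close>
  have sm: "summable (\<lambda>i. real_of_int (a i) / 2 ^ i)"
  proof (rule summable_comparison_test')
    show "summable (\<lambda>i. 3 * (1/2) ^ i :: real)" by (intro summable_mult summable_geometric) auto
    show "norm (real_of_int (a i) / 2 ^ i) \<le> 3 * (1/2) ^ i" for i
      using assms[rule_format, of i] by (auto simp: power_one_over divide_simps)
  qed
  show ?thesis unfolding kraft_partial_sums_int_iff
  proof
    assume "\<forall>n. (\<Sum>i\<le>n. real_of_int (a i) / 2 ^ i) \<le> 1"
    then show "(\<Sum>i. real_of_int (a i) / 2 ^ i) \<le> 1"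
      by (intro summable_nonneg_partial_sums nn) auto
  next
    assume "(\<Sum>i. real_of_int (a i) / 2 ^ i) \<le> 1"
    then show "\<forall>n. (\<Sum>i\<le>n. real_of_int (a i) / 2 ^ i) \<le> 1"
      using sum_le_suminf[OF sm] nn by (meson finite_atMost order_trans)
  qed
qed

subsection \<open>Histories and stopped walks\<close>

definition sign_words :: "nat \<Rightarrow> int list set" where
  "sign_words n = {s. set s \<subseteq> {1, -1} \<and> length s = n}"

lemma finite_sign_words [simp]: "finite (sign_words n)"
  unfolding sign_words_def by (rule finite_lists_length_eq) simp

lemma card_sign_words: "card (sign_words n) = 2 ^ n"
  unfolding sign_words_def by (subst card_lists_length_eq) (auto simp: numeral_2_eq_2)

lemma sign_words_Suc_append: "s @ [e] \<in> sign_words (Suc n) \<longleftrightarrow> s \<in> sign_words n \<and> e \<in> {1, -1}"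
  by (auto simp: sign_words_def)

definition history :: "(nat \<Rightarrow> 'a \<Rightarrow> int) \<Rightarrow> nat \<Rightarrow> 'a \<Rightarrow> int list" where
  "history \<xi> n \<omega> = map (\<lambda>i. \<xi> (Suc i) \<omega>) [0..<n]"

lemma length_history [simp]: "length (history \<xi> n \<omega>) = n"
  by (simp add: history_def)

lemma history_0 [simp]: "history \<xi> 0 \<omega> = []"
  by (simp add: history_def)

lemma history_Suc: "history \<xi> (Suc n) \<omega> = history \<xi> n \<omega> @ [\<xi> (Suc n) \<omega>]"
  by (simp add: history_def)

lemma take_history: "take m (history \<xi> n \<omega>) = history \<xi> (min m n) \<omega>"
  by (simp add: history_def take_map min_def)

lemma history_eq_mono:
  assumes "history \<xi> n \<omega> = history \<xi> n \<omega>'" "m \<le> n"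
  shows "history \<xi> m \<omega> = history \<xi> m \<omega>'"
  using take_history[of m \<xi> n \<omega>] take_history[of m \<xi> n \<omega>'] assms by (simp add: min_def)

lemma walk_0 [simp]: "walk \<xi> 0 \<omega> = 0"
  by (simp add: walk_def)

lemma walk_Suc: "walk \<xi> (Suc n) \<omega> = walk \<xi> n \<omega> + \<xi> (Suc n) \<omega>"
  by (simp add: walk_def)

lemma walk_eq_sum_list: "walk \<xi> n \<omega> = sum_list (history \<xi> n \<omega>)"
  by (induction n) (simp_all add: history_Suc walk_Suc)

section \<open>The natural filtration, stopped paths and cylinders\<close>

lemma space_natural_filtration [simp]: "space (natural_filtration M X t) = space M"
  by (simp add: natural_filtration_def space_measure_of_conv)

lemma sets_natural_filtration:
  "sets (natural_filtration M X t) = sigma_sets (space M) {X k -` B \<inter> space M | k B. enat k \<le> t}"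
  unfolding natural_filtration_def by (rule sets_measure_of) auto

lemma sets_natural_filtration_mono:
  "t \<le> u \<Longrightarrow> sets (natural_filtration M X t) \<subseteq> sets (natural_filtration M X u)"
  unfolding sets_natural_filtration by (rule sigma_sets_mono') (auto intro: order_trans)

lemma measurable_natural_filtration:
  "enat k \<le> t \<Longrightarrow> X k \<in> measurable (natural_filtration M X t) (count_space UNIV)"
  by (rule measurableI) (auto simp: sets_natural_filtration intro!: sigma_sets.Basic)

text \<open>The generators depend only on the path up to \<open>t\<close>, and complements and
  countable unions preserve this.\<close>

lemma natural_filtration_determined:
  assumes "A \<in> sets (natural_filtration M X t)" "\<omega> \<in> space M" "\<omega>' \<in> space M"
    "\<And>k. enat k \<le> t \<Longrightarrow> X k \<omega> = X k \<omega>'"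
  shows "\<omega> \<in> A \<longleftrightarrow> \<omega>' \<in> A"
  using assms(1) unfolding sets_natural_filtration
  by (induction rule: sigma_sets.induct) (use assms(2-) in auto)

text \<open>The filtration is generated by positions, so steps are recovered as differences of
  consecutive positions. An arbitrary \<open>P\<close> is allowed because there are only countably
  many integer lists.\<close>

lemma pred_history_natural_filtration:
  "Measurable.pred (natural_filtration M (walk \<xi>) (enat n)) (\<lambda>\<omega>. P (history \<xi> n \<omega>))"
proof -
  let ?F = "natural_filtration M (walk \<xi>) (enat n)"
  have [measurable]: "walk \<xi> k \<in> measurable ?F (count_space UNIV)" if "k \<le> n" for k
    using that by (intro measurable_natural_filtration) simp
  have "Measurable.pred ?F (\<lambda>\<omega>. history \<xi> n \<omega> = s)" for s
  proof -
    have 1: "Measurable.pred ?F (\<lambda>\<omega>. walk \<xi> (Suc i) \<omega> = walk \<xi> i \<omega> + c)" if "i < n" for i c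
    proof -
      have [measurable]: "walk \<xi> (Suc i) \<in> measurable ?F (count_space UNIV)"
        "walk \<xi> i \<in> measurable ?F (count_space UNIV)"
        using that by (auto intro!: measurable_natural_filtration)
      show ?thesis by measurable
    qed
    have "(\<lambda>\<omega>. history \<xi> n \<omega> = s) =
        (\<lambda>\<omega>. length s = n \<and> (\<forall>i\<in>{..<n}. walk \<xi> (Suc i) \<omega> = walk \<xi> i \<omega> + s ! i))"
      by (auto simp: history_def list_eq_iff_nth_eq walk_Suc)
    also have "Measurable.pred ?F \<dots>"
      using 1 by (intro pred_intros_logic pred_intros_finite) auto
    finally show ?thesis .
  qed
  then have "Measurable.pred ?F (\<lambda>\<omega>. \<exists>s\<in>{s. P s}. history \<xi> n \<omega> = s)"
    by (intro pred_intros_countable_bounded) auto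
  then show ?thesis by simp
qed

lemma stopped_eq: "stopped X \<tau> n \<omega> = X (the_enat (min (enat n) (\<tau> \<omega>))) \<omega>"
  by (simp add: stopped_def value_at_def)

lemma stopped_not_stopped: "enat n \<le> \<tau> \<omega> \<Longrightarrow> stopped X \<tau> n \<omega> = X n \<omega>"
  by (simp add: stopped_eq min_def)

lemma stopped_stopped: "\<tau> \<omega> \<le> enat n \<Longrightarrow> stopped X \<tau> n \<omega> = value_at X \<tau> \<omega>"
  by (auto simp: stopped_eq value_at_def min_def)

lemma stopped_0 [simp]: "stopped (walk \<xi>) \<tau> 0 \<omega> = 0"
  by (simp add: stopped_not_stopped flip: zero_enat_def)

lemma stopped_Suc:
  "stopped (walk \<xi>) \<tau> (Suc n) \<omega> =
     stopped (walk \<xi>) \<tau> n \<omega> + (if \<tau> \<omega> \<le> enat n then 0 else \<xi> (Suc n) \<omega>)"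
proof (cases "\<tau> \<omega> \<le> enat n")
  case True
  then have "\<tau> \<omega> \<le> enat (Suc n)" by (rule order_trans) simp
  then show ?thesis using True by (simp add: stopped_stopped)
next
  case False
  then have "enat n \<le> \<tau> \<omega>" "enat (Suc n) \<le> \<tau> \<omega>" by (cases "\<tau> \<omega>"; simp)+
  then show ?thesis using False by (simp add: stopped_not_stopped walk_Suc)
qed

context simple_symmetric_random_walk
begin

abbreviation "\<F> n \<equiv> natural_filtration M (walk \<xi>) (enat n)"

lemma measurable_step: "k \<ge> 1 \<Longrightarrow> \<xi> k \<in> measurable M (count_space UNIV)"
  using indep_steps unfolding indep_vars_def2 by simp

lemma measurable_walk [measurable]: "walk \<xi> n \<in> measurable M (count_space UNIV)"
proof (induction n)
  case (Suc n)
  have [measurable]: "\<xi> (Suc n) \<in> measurable M (count_space UNIV)" by (rule measurable_step) simp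
  note Suc[measurable]
  have "(\<lambda>\<omega>. walk \<xi> n \<omega> + \<xi> (Suc n) \<omega>) \<in> measurable M (count_space UNIV)"
    by measurable
  then show ?case by (simp add: walk_Suc[abs_def])
qed (simp add: walk_def)

lemma sets_filtration_subset: "sets (natural_filtration M (walk \<xi>) t) \<subseteq> sets M"
  unfolding sets_natural_filtration
  by (rule sets.sigma_sets_subset) (auto intro!: measurable_sets[OF measurable_walk])

lemma subalgebra_filtration: "subalgebra M (natural_filtration M (walk \<xi>) t)"
  using sets_filtration_subset by (simp add: subalgebra_def)

lemma filtration_F: "filtration (space M) \<F>"
  by standard (simp_all add: sets_natural_filtration_mono)

text \<open>The steps may take other values on a null set, so path arguments relying on steps of
  size one either assume it or hold almost surely.\<close>

lemma AE_steps: "AE \<omega> in M. \<forall>k\<ge>1. \<xi> k \<omega> \<in> {1, -1}"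
proof -
  have "AE \<omega> in M. k \<ge> 1 \<longrightarrow> \<xi> k \<omega> \<in> {1, -1}" for k
  proof (cases "k \<ge> 1")
    case True
    note [measurable] = measurable_step[OF True]
    have "prob ({\<omega> \<in> space M. \<xi> k \<omega> = 1} \<union> {\<omega> \<in> space M. \<xi> k \<omega> = -1}) = 1"
      by (subst finite_measure_Union) (auto simp: prob_up[OF True] prob_down[OF True])
    then have "AE \<omega> in M. \<omega> \<in> {\<omega> \<in> space M. \<xi> k \<omega> = 1} \<union> {\<omega> \<in> space M. \<xi> k \<omega> = -1}"
      by (subst prob_eq_1[symmetric]) auto
    then show ?thesis by eventually_elim auto
  qed simp
  then show ?thesis by (simp add: AE_all_countable)
qed

lemma AE_history: "AE \<omega> in M. \<forall>n. history \<xi> n \<omega> \<in> sign_words n"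
  using AE_steps by eventually_elim (auto simp: history_def sign_words_def)

definition cylinder :: "int list \<Rightarrow> 'a set" where
  "cylinder s = {\<omega> \<in> space M. history \<xi> (length s) \<omega> = s}"

lemma cylinder_filtration: "cylinder s \<in> sets (\<F> (length s))"
  using pred_history_natural_filtration[where M = M and \<xi> = \<xi> and n = "length s" and P = "\<lambda>x. x = s"]
  by (simp add: cylinder_def pred_def)

lemma cylinder_sets [measurable]: "cylinder s \<in> sets M"
  using cylinder_filtration sets_filtration_subset by blast

lemma cylinder_append: "cylinder (s @ t) \<subseteq> cylinder s"
  unfolding cylinder_def using take_history[of "length s" \<xi> "length (s @ t)"]
  by (auto simp: min_def) (metis append_eq_conv_conj)

lemma prob_cylinder:
  assumes "set s \<subseteq> {1, -1}"
  shows "prob (cylinder s) = 1 / 2 ^ length s"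
\<comment> \<open>Independence speaks of nonempty index sets, and the empty intersection would be
  the whole type instead of \<open>space M\<close>.\<close>
proof (cases "s = []")
  case True
  then show ?thesis by (simp add: cylinder_def prob_space)
next
  case False
  define A where "A k = \<xi> k -` {s ! (k - 1)} \<inter> space M" for k
  have "indep_sets (\<lambda>i. {\<xi> i -` A \<inter> space M |A. A \<in> sets (count_space UNIV)}) {1..}"
    using indep_steps unfolding indep_vars_def2 by simp
  then have "prob (\<Inter>k\<in>{1..length s}. A k) = (\<Prod>k\<in>{1..length s}. prob (A k))"
    by (rule indep_setsD) (use False in \<open>auto simp: A_def Suc_le_eq\<close>)
  also have "\<dots> = (\<Prod>k\<in>{1..length s}. 1 / 2)"
  proof (rule prod.cong)
    fix k assume k: "k \<in> {1..length s}"
    then have "s ! (k - 1) \<in> set s" by (intro nth_mem) auto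
    then have "s ! (k - 1) \<in> {1, -1}" using assms by blast
    then show "prob (A k) = 1 / 2"
      using k prob_up[of k] prob_down[of k] by (auto simp: A_def vimage_def Int_def conj_commute)
  qed simp
  also have "(\<Inter>k\<in>{1..length s}. A k) = cylinder s"
  proof -
    have "(\<forall>k\<in>{1..length s}. \<xi> k \<omega> = s ! (k - 1)) \<longleftrightarrow> history \<xi> (length s) \<omega> = s" for \<omega>
    proof -
      have *: "{1..length s} = Suc ` {..<length s}" by (simp add: image_Suc_lessThan)
      have "(\<forall>k\<in>{1..length s}. \<xi> k \<omega> = s ! (k - 1)) \<longleftrightarrow> (\<forall>i<length s. \<xi> (Suc i) \<omega> = s ! i)"
        unfolding * by auto
      moreover have "(\<forall>i<length s. \<xi> (Suc i) \<omega> = s ! i) \<longleftrightarrow> history \<xi> (length s) \<omega> = s"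
        by (auto simp: history_def list_eq_iff_nth_eq[of _ s])
      ultimately show ?thesis by (rule trans)
    qed
    moreover have "(\<Inter>k\<in>{1..length s}. A k) = {\<omega> \<in> space M. \<forall>k\<in>{1..length s}. \<xi> k \<omega> = s ! (k - 1)}"
    proof -
      have "{1..length s} \<noteq> {}" using False by (cases s) auto
      then show ?thesis by (auto simp: A_def simp del: atLeastatMost_empty_iff)
    qed
    ultimately show ?thesis by (simp only: cylinder_def)
  qed
  finally show ?thesis by (simp add: power_one_over)
qed

text \<open>All outcomes of a cylinder of length \<open>n\<close> share the path up to
  \<open>n\<close>, so the cylinder acts as an atom of \<open>\<F> n\<close>.\<close>

lemma filtration_cylinder_cases:
  assumes "A \<in> sets (\<F> n)" "length s = n"
  shows "cylinder s \<subseteq> A \<or> cylinder s \<inter> A = {}"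
proof -
  have "\<omega> \<in> A \<longleftrightarrow> \<omega>' \<in> A" if "\<omega> \<in> cylinder s" "\<omega>' \<in> cylinder s" for \<omega> \<omega>'
  proof (rule natural_filtration_determined[OF assms(1)])
    fix k assume "enat k \<le> enat n"
    then have k: "k \<le> n" by simp
    have "history \<xi> n \<omega> = history \<xi> n \<omega>'"
      using that unfolding cylinder_def assms(2) by simp
    from history_eq_mono[OF this k]
    show "walk \<xi> k \<omega> = walk \<xi> k \<omega>'" by (simp add: walk_eq_sum_list)
  qed (use that in \<open>simp_all add: cylinder_def\<close>)
  then show ?thesis by blast
qed

lemma prob_UN_cylinder:
  assumes "finite S" "\<And>s. s \<in> S \<Longrightarrow> set s \<subseteq> {1, -1}"
    "\<And>s t. s \<in> S \<Longrightarrow> t \<in> S \<Longrightarrow> s \<noteq> t \<Longrightarrow> cylinder s \<inter> cylinder t = {}"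
  shows "prob (\<Union>s\<in>S. cylinder s) = (\<Sum>s\<in>S. 1 / 2 ^ length s)"
proof -
  have "prob (\<Union>s\<in>S. cylinder s) = (\<Sum>s\<in>S. prob (cylinder s))"
    by (rule finite_measure_finite_Union) (use assms in \<open>auto simp: disjoint_family_on_def\<close>)
  then show ?thesis using assms(2) by (simp add: prob_cylinder)
qed

lemma cylinder_disjoint: "length s = length t \<Longrightarrow> s \<noteq> t \<Longrightarrow> cylinder s \<inter> cylinder t = {}"
  by (auto simp: cylinder_def)

text \<open>Up to a null set, an event of \<open>\<F> n\<close> is a union of cylinders of length \<open>n\<close>, each of which
  is halved by the next step.\<close>

lemma prob_filtration_step:
  assumes A: "A \<in> sets (\<F> n)" and e: "e \<in> {1, -1}"
  shows "prob (A \<inter> {\<omega> \<in> space M. \<xi> (Suc n) \<omega> = e}) =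
    real (card {s \<in> sign_words n. cylinder s \<subseteq> A}) / 2 ^ Suc n"
proof -
  let ?S = "{s \<in> sign_words n. cylinder s \<subseteq> A}"
  have [measurable]: "A \<in> sets M" using A sets_filtration_subset by blast
  have [measurable]: "\<xi> (Suc n) \<in> measurable M (count_space UNIV)" by (rule measurable_step) simp
  have eq: "history \<xi> n \<omega> = s \<and> \<xi> (Suc n) \<omega> = e \<longleftrightarrow> history \<xi> (Suc n) \<omega> = s @ [e]" for s \<omega>
    by (simp add: history_Suc)
  have "AE \<omega> in M. \<omega> \<in> A \<inter> {\<omega> \<in> space M. \<xi> (Suc n) \<omega> = e} \<longleftrightarrow> \<omega> \<in> (\<Union>s\<in>(\<lambda>s. s @ [e]) ` ?S. cylinder s)"
    using AE_history AE_space
  proof eventually_elim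
    case (elim \<omega>)
    have "\<omega> \<in> cylinder (history \<xi> n \<omega>)" using elim by (simp add: cylinder_def)
    then have "\<omega> \<in> A \<longleftrightarrow> cylinder (history \<xi> n \<omega>) \<subseteq> A"
      using filtration_cylinder_cases[OF A, of "history \<xi> n \<omega>"] by auto
    then show ?case
      using elim by (auto simp: cylinder_def history_Suc sign_words_def)
  qed
  then have "prob (A \<inter> {\<omega> \<in> space M. \<xi> (Suc n) \<omega> = e}) = prob (\<Union>s\<in>(\<lambda>s. s @ [e]) ` ?S. cylinder s)"
    by (rule finite_measure_eq_AE) (auto intro!: sets.finite_UN)
  also have "\<dots> = (\<Sum>s\<in>(\<lambda>s. s @ [e]) ` ?S. 1 / 2 ^ length s)"
  proof (rule prob_UN_cylinder)
    show "cylinder s \<inter> cylinder t = {}" if "s \<in> (\<lambda>s. s @ [e]) ` ?S" "t \<in> (\<lambda>s. s @ [e]) ` ?S" "s \<noteq> t" for s t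
      using that by (intro cylinder_disjoint) (auto simp: sign_words_def)
    show "finite ((\<lambda>s. s @ [e]) ` ?S)" by (intro finite_imageI) simp
  qed (use e in \<open>auto simp: sign_words_def\<close>)
  also have "\<dots> = (\<Sum>s\<in>?S. 1 / 2 ^ Suc n)"
    by (subst sum.reindex) (auto simp: inj_on_def sign_words_def intro!: sum.cong)
  finally show ?thesis by simp
qed

text \<open>The formula of \<open>prob_filtration_step\<close> does not depend on the sign, so the
  next step is fair on every event of the past.\<close>

lemma integral_filtration_step:
  assumes A: "A \<in> sets (\<F> n)"
  shows "integrable M (\<lambda>\<omega>. indicator A \<omega> * real_of_int (\<xi> (Suc n) \<omega>))"
    "(\<integral>\<omega>. indicator A \<omega> * real_of_int (\<xi> (Suc n) \<omega>) \<partial>M) = 0"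
proof -
  have [measurable]: "A \<in> sets M" using A sets_filtration_subset by blast
  have [measurable]: "\<xi> (Suc n) \<in> measurable M (count_space UNIV)" by (rule measurable_step) simp
  define A' where "A' e = A \<inter> {\<omega> \<in> space M. \<xi> (Suc n) \<omega> = e}" for e
  have [measurable]: "A' e \<in> sets M" for e unfolding A'_def by measurable
  have AE: "AE \<omega> in M. indicator A \<omega> * real_of_int (\<xi> (Suc n) \<omega>)
      = indicator (A' 1) \<omega> - (indicator (A' (-1)) \<omega> :: real)"
    using AE_steps AE_space
  proof eventually_elim
    case (elim \<omega>)
    then have "\<xi> (Suc n) \<omega> = 1 \<or> \<xi> (Suc n) \<omega> = -1" by auto
    then show ?case using elim by (auto simp: A'_def indicator_def)
  qed
  have int: "integrable M (\<lambda>\<omega>. indicator (A' 1) \<omega> - (indicator (A' (-1)) \<omega> :: real))"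
    by (intro Bochner_Integration.integrable_diff integrable_real_indicator) (auto simp: emeasure_eq_measure)
  show "integrable M (\<lambda>\<omega>. indicator A \<omega> * real_of_int (\<xi> (Suc n) \<omega>))"
    by (subst integrable_cong_AE[OF _ _ AE]) (use int in \<open>auto intro: borel_measurable_integrable\<close>)
  have "(\<integral>\<omega>. indicator A \<omega> * real_of_int (\<xi> (Suc n) \<omega>) \<partial>M)
      = (\<integral>\<omega>. indicator (A' 1) \<omega> - (indicator (A' (-1)) \<omega> :: real) \<partial>M)"
    by (rule integral_cong_AE[OF _ _ AE]) auto
  also have "\<dots> = prob (A' 1) - prob (A' (-1))"
    by (subst Bochner_Integration.integral_diff) (auto simp: emeasure_eq_measure)
  also have "\<dots> = 0" unfolding A'_def by (subst (1 2) prob_filtration_step[OF A]) auto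
  finally show "(\<integral>\<omega>. indicator A \<omega> * real_of_int (\<xi> (Suc n) \<omega>) \<partial>M) = 0" .
qed

end

section \<open>Stopped walks as martingales\<close>

locale stopped_walk = simple_symmetric_random_walk +
  fixes \<tau> :: "'a \<Rightarrow> enat"
  assumes stopping: "stopping_time (natural_filtration M (walk \<xi>)) \<tau>"
begin

abbreviation "Y n \<omega> \<equiv> real_of_int (stopped (walk \<xi>) \<tau> n \<omega>)"

lemma stopping_sets: "{\<omega> \<in> space M. \<tau> \<omega> \<le> enat n} \<in> sets (\<F> n)"
  using stopping_timeD[OF stopping, of "enat n"] by (simp add: pred_def)

lemma measurable_\<tau> [measurable]: "\<tau> \<in> measurable M (count_space UNIV)"
proof -
  have le: "Measurable.pred M (\<lambda>\<omega>. \<tau> \<omega> \<le> t)" for t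
    using stopping_timeD[OF stopping, of t] measurable_from_subalg[OF subalgebra_filtration] by blast
  have "Measurable.pred M (\<lambda>\<omega>. \<tau> \<omega> = t)" for t
  proof (cases t)
    case (enat n)
    have "(\<lambda>\<omega>. \<tau> \<omega> = enat n) = (\<lambda>\<omega>. \<tau> \<omega> \<le> enat n \<and> (\<forall>m\<in>{..<n}. \<not> \<tau> \<omega> \<le> enat m))"
    proof (rule ext)
      fix \<omega> show "\<tau> \<omega> = enat n \<longleftrightarrow> \<tau> \<omega> \<le> enat n \<and> (\<forall>m\<in>{..<n}. \<not> \<tau> \<omega> \<le> enat m)"
      proof (cases "\<tau> \<omega>")
        case (enat k)
        have "k = n \<longleftrightarrow> k \<le> n \<and> (\<forall>m<n. \<not> k \<le> m)"
          by (metis leD le_neq_implies_less order_refl)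
        then show ?thesis by (simp add: enat Ball_def)
      qed simp
    qed
    then show ?thesis unfolding enat using le by simp
  next
    case infinity
    have "(\<lambda>\<omega>. \<tau> \<omega> = \<infinity>) = (\<lambda>\<omega>. \<forall>m. \<not> \<tau> \<omega> \<le> enat m)"
      by (rule ext) (metis enat_ord_simps(5) not_infinity_eq order_refl)
    then show ?thesis unfolding infinity using le by simp
  qed
  then show ?thesis
    by (subst measurable_count_space_eq2_countable) (auto simp: pred_def vimage_def Int_def conj_commute)
qed

lemma measurable_value_at [measurable]: "value_at (walk \<xi>) \<tau> \<in> measurable M (count_space UNIV)"
  unfolding value_at_def
  by (rule measurable_compose_countable'[where I = UNIV and g = "\<lambda>\<omega>. the_enat (\<tau> \<omega>)"]) auto

lemma stopped_filtration: "stopped (walk \<xi>) \<tau> n \<in> measurable (\<F> n) (count_space UNIV)"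
proof (induction n)
  case (Suc n)
  have sub: "measurable (\<F> n) (count_space UNIV) \<subseteq> measurable (\<F> (Suc n)) (count_space UNIV)"
    using sets_natural_filtration_mono[of "enat n" "enat (Suc n)" M "walk \<xi>"]
    by (intro measurable_mono) auto
  have "(\<lambda>\<omega>. if \<tau> \<omega> \<le> enat n then stopped (walk \<xi>) \<tau> n \<omega> else walk \<xi> (Suc n) \<omega>)
      \<in> measurable (\<F> (Suc n)) (count_space UNIV)"
  proof (rule measurable_If)
    show "{\<omega> \<in> space (\<F> (Suc n)). \<tau> \<omega> \<le> enat n} \<in> sets (\<F> (Suc n))"
      using stopping_sets[of n] sets_natural_filtration_mono[of "enat n" "enat (Suc n)" M "walk \<xi>"]
      by auto
  qed (use Suc sub in \<open>auto intro: measurable_natural_filtration\<close>)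
  also have "(\<lambda>\<omega>. if \<tau> \<omega> \<le> enat n then stopped (walk \<xi>) \<tau> n \<omega> else walk \<xi> (Suc n) \<omega>)
      = stopped (walk \<xi>) \<tau> (Suc n)"
  proof (rule ext)
    fix \<omega> show "(if \<tau> \<omega> \<le> enat n then stopped (walk \<xi>) \<tau> n \<omega> else walk \<xi> (Suc n) \<omega>)
        = stopped (walk \<xi>) \<tau> (Suc n) \<omega>"
      by (cases "\<tau> \<omega>") (auto simp: stopped_Suc walk_Suc stopped_not_stopped)
  qed
  finally show ?case .
qed simp

lemma measurable_stopped [measurable]: "stopped (walk \<xi>) \<tau> n \<in> measurable M (count_space UNIV)"
  using stopped_filtration measurable_from_subalg[OF subalgebra_filtration] by blast

lemma AE_stopped_le: "AE \<omega> in M. \<bar>Y n \<omega>\<bar> \<le> real n"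
  using AE_steps
proof eventually_elim
  case (elim \<omega>)
  show ?case
  proof (induction n)
    case (Suc n)
    have "\<xi> (Suc n) \<omega> = 1 \<or> \<xi> (Suc n) \<omega> = -1" using elim by auto
    then show ?case using Suc by (auto simp: stopped_Suc)
  qed simp
qed

lemma integrable_stopped: "integrable M (Y n)"
  by (rule integrable_const_bound[where B = "real n"]) (use AE_stopped_le in auto)

text \<open>The stopped walk moves at time \<open>Suc n\<close> only where \<open>\<tau>\<close> has
  not occurred by time \<open>n\<close>. This event lies in \<open>\<F> n\<close>, so the fair next
  step integrates to 0 over it.\<close>

lemma integral_stopped_Suc:
  assumes "A \<in> sets (\<F> n)"
  shows "(\<integral>\<omega>. indicator A \<omega> * Y (Suc n) \<omega> \<partial>M) = (\<integral>\<omega>. indicator A \<omega> * Y n \<omega> \<partial>M)"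
proof -
  define B where "B = A \<inter> {\<omega> \<in> space M. \<not> \<tau> \<omega> \<le> enat n}"
  have "{\<omega> \<in> space M. \<not> \<tau> \<omega> \<le> enat n} = space (\<F> n) - {\<omega> \<in> space M. \<tau> \<omega> \<le> enat n}" by auto
  then have B: "B \<in> sets (\<F> n)" unfolding B_def using assms stopping_sets[of n] by (metis sets.Int sets.compl_sets)
  have A[measurable]: "A \<in> sets M" using assms sets_filtration_subset by blast
  have "(\<integral>\<omega>. indicator A \<omega> * Y (Suc n) \<omega> \<partial>M)
      = (\<integral>\<omega>. indicator A \<omega> * Y n \<omega> + indicator B \<omega> * real_of_int (\<xi> (Suc n) \<omega>) \<partial>M)"
    by (rule Bochner_Integration.integral_cong) (auto simp: stopped_Suc B_def indicator_def)
  also have "\<dots> = (\<integral>\<omega>. indicator A \<omega> * Y n \<omega> \<partial>M)"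
    using integral_filtration_step[OF B] integrable_real_mult_indicator[OF A integrable_stopped[of n]]
    by (subst Bochner_Integration.integral_add) (auto simp: mult.commute)
  finally show ?thesis .
qed

lemma integral_stopped:
  assumes "A \<in> sets (\<F> m)" "m \<le> n"
  shows "(\<integral>\<omega>. indicator A \<omega> * Y n \<omega> \<partial>M) = (\<integral>\<omega>. indicator A \<omega> * Y m \<omega> \<partial>M)"
  using assms(2)
proof (induction n rule: dec_induct)
  case (step n)
  have "A \<in> sets (\<F> n)" using assms(1) step sets_natural_filtration_mono[of "enat m" "enat n"] by auto
  then show ?case using step integral_stopped_Suc by simp
qed simp

lemma martingale_stopped: "martingale M \<F> Y"
  unfolding martingale_def
proof (intro conjI allI impI)
  show Y: "Y n \<in> borel_measurable (\<F> n)" for n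
    using stopped_filtration[of n] by measurable
  fix m n :: nat assume "m \<le> n"
  interpret finite_measure_subalgebra M "\<F> m"
    by standard (rule subalgebra_filtration)
  show "AE \<omega> in M. real_cond_exp M (\<F> m) (Y n) \<omega> = Y m \<omega>"
    by (rule real_cond_exp_charact)
      (use integral_stopped[OF _ \<open>m \<le> n\<close>] integrable_stopped Y in \<open>auto simp: set_lebesgue_integral_def\<close>)
qed (use filtration_F subalgebra_filtration integrable_stopped in auto)

end

subsection \<open>Uniformly integrable stopping times yield Kraft sums\<close>

text \<open>A path that is at 0 at every even time must undo each odd-numbered step \<open>x\<close>
  by \<open>-x\<close>, so its odd-numbered steps determine it.\<close>

definition excursions :: "int list \<Rightarrow> int list" where
  "excursions s = concat (map (\<lambda>x. [x, -x]) s)"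

lemma excursions_Nil [simp]: "excursions [] = []"
  by (simp add: excursions_def)

lemma excursions_Cons: "excursions (x # s) = x # -x # excursions s"
  by (simp add: excursions_def)

lemma excursions_append: "excursions (s @ t) = excursions s @ excursions t"
  by (simp add: excursions_def)

lemma length_excursions [simp]: "length (excursions s) = 2 * length s"
  by (induction s) (simp_all add: excursions_Cons)

lemma sum_list_excursions [simp]: "sum_list (excursions s) = 0"
  by (induction s) (simp_all add: excursions_Cons)

lemma set_excursions: "set s \<subseteq> {1, -1} \<Longrightarrow> set (excursions s) \<subseteq> {1, -1}"
  by (induction s) (auto simp: excursions_Cons)

lemma inj_excursions: "inj excursions"
proof (rule injI)
  fix s t assume "excursions s = excursions t"
  then show "s = t"
  proof (induction s arbitrary: t)
    case Nil
    then have "length (excursions t) = 0" by (metis excursions_Nil length_0_conv)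
    then show ?case by simp
  next
    case (Cons x s)
    then show ?case by (cases t) (auto simp: excursions_Cons)
  qed
qed

lemma history_excursions:
  assumes "\<And>j. j \<le> n \<Longrightarrow> walk \<xi> (2 * j) \<omega> = 0"
  shows "history \<xi> (2 * n) \<omega> = excursions (map (\<lambda>j. \<xi> (Suc (2 * j)) \<omega>) [0..<n])"
  using assms
proof (induction n)
  case (Suc n)
  have "walk \<xi> (2 * n) \<omega> = 0" "walk \<xi> (2 * Suc n) \<omega> = 0" using Suc.prems[of n] Suc.prems[of "Suc n"] by simp_all
  then have "\<xi> (Suc (Suc (2 * n))) \<omega> = - \<xi> (Suc (2 * n)) \<omega>" by (simp add: walk_Suc)
  then show ?case using Suc by (simp add: history_Suc excursions_append excursions_Cons)
qed simp

lemma even_walk_iff: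
  assumes "\<forall>k\<ge>1. \<xi> k \<omega> \<in> {1, -1}"
  shows "even (walk \<xi> n \<omega>) \<longleftrightarrow> even n"
proof (induction n)
  case (Suc n)
  have "\<xi> (Suc n) \<omega> \<in> {1, -1}" using assms by simp
  then have "odd (\<xi> (Suc n) \<omega>)" by auto
  then show ?case using Suc by (simp add: walk_Suc)
qed simp

context simple_symmetric_random_walk
begin

text \<open>Kraft's inequality, as the additivity of the probability of the disjoint cylinders.\<close>

lemma kraft_inequality:
  assumes "\<And>s t. P s \<Longrightarrow> P (s @ t) \<Longrightarrow> t = []"
  shows "(\<Sum>n\<le>N. real (card {s \<in> sign_words n. P s}) / 2 ^ n) \<le> 1"
proof -
  define S where "S n = {s \<in> sign_words n. P s}" for n
  have fin: "finite (S n)" for n by (simp add: S_def)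
  have len: "length s = n" if "s \<in> S n" for s n using that by (simp add: S_def sign_words_def)
  \<comment> \<open>Words whose cylinders share an outcome are prefixes of the same history, hence
    comparable.\<close>
  have prefix: "s = t" if "P s" "P t" "\<omega> \<in> cylinder s" "\<omega> \<in> cylinder t" "length s \<le> length t" for s t \<omega>
  proof -
    have h: "history \<xi> (length s) \<omega> = s" "history \<xi> (length t) \<omega> = t"
      using that by (simp_all add: cylinder_def)
    have "take (length s) t = s"
      using take_history[of "length s" \<xi> "length t" \<omega>] that(5) unfolding h by (simp add: min_def h)
    then have t: "s @ drop (length s) t = t" by (metis append_take_drop_id)
    then have "drop (length s) t = []" using assms[of s "drop (length s) t"] that by simp
    then show ?thesis using t by simp
  qed
  have "(\<Sum>n\<le>N. real (card (S n)) / 2 ^ n) = (\<Sum>n\<le>N. \<Sum>s\<in>S n. 1 / 2 ^ length s)"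
    using len by simp
  also have "\<dots> = (\<Sum>s\<in>(\<Union>n\<le>N. S n). 1 / 2 ^ length s)"
  proof (rule sum.UNION_disjoint[symmetric])
    show "\<forall>i\<in>{..N}. \<forall>j\<in>{..N}. i \<noteq> j \<longrightarrow> S i \<inter> S j = {}" using len by (metis disjoint_iff)
  qed (simp_all add: fin)
  \<comment> \<open>The sign words themselves, not their excursions, serve as step histories here;
    this gives weight \<open>1 / 2 ^ n\<close> instead of \<open>1 / 4 ^ n\<close>.\<close>
  also have "\<dots> = prob (\<Union>s\<in>(\<Union>n\<le>N. S n). cylinder s)"
  proof (rule prob_UN_cylinder[symmetric])
    show "finite (\<Union>n\<le>N. S n)" using fin by simp
    show "set s \<subseteq> {1, -1}" if "s \<in> (\<Union>n\<le>N. S n)" for s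
      using that by (auto simp: S_def sign_words_def)
    fix s t assume "s \<in> (\<Union>n\<le>N. S n)" "t \<in> (\<Union>n\<le>N. S n)" "s \<noteq> t"
    then have "P s" "P t" by (auto simp: S_def)
    then show "cylinder s \<inter> cylinder t = {}"
      using prefix[of s t] prefix[of t s] \<open>s \<noteq> t\<close> nat_le_linear[of "length s" "length t"] by blast
  qed
  also have "\<dots> \<le> 1" by (rule prob_le_1)
  finally show ?thesis by (simp add: S_def)
qed

end

context stopped_walk
begin

lemma stopping_determined:
  assumes "\<omega> \<in> cylinder s" "\<omega>' \<in> cylinder s" "k \<le> length s"
  shows "\<tau> \<omega> \<le> enat k \<longleftrightarrow> \<tau> \<omega>' \<le> enat k"
proof -
  have "cylinder s \<subseteq> cylinder (take k s)"
    using cylinder_append[of "take k s" "drop k s"] by simp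
  then have "\<omega> \<in> cylinder (take k s)" "\<omega>' \<in> cylinder (take k s)" using assms by auto
  moreover have "\<omega> \<in> space M" "\<omega>' \<in> space M" using assms by (simp_all add: cylinder_def)
  ultimately show ?thesis
    using filtration_cylinder_cases[OF stopping_sets[of k], of "take k s"] assms(3) by auto
qed

lemma stopping_determined_eq:
  assumes "\<omega> \<in> cylinder s" "\<omega>' \<in> cylinder s" "k \<le> length s" "\<tau> \<omega> = enat k"
  shows "\<tau> \<omega>' = enat k"
proof -
  have "\<tau> \<omega>' \<le> enat k" using stopping_determined[OF assms(1-3)] assms(4) by simp
  then obtain j where j: "\<tau> \<omega>' = enat j" "j \<le> k" by (cases "\<tau> \<omega>'") auto
  then have "\<tau> \<omega> \<le> enat j" using stopping_determined[OF assms(1,2), of j] assms(3) by simp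
  then show ?thesis using j assms(4) by simp
qed

lemma prob_not_stopped_tendsto:
  assumes "AE \<omega> in M. \<tau> \<omega> \<noteq> \<infinity>"
  shows "(\<lambda>m. prob {\<omega> \<in> space M. \<not> \<tau> \<omega> \<le> enat m}) \<longlonglongrightarrow> 0"
proof -
  let ?A = "\<lambda>m. {\<omega> \<in> space M. \<not> \<tau> \<omega> \<le> enat m}"
  have "(\<lambda>m. prob (?A m)) \<longlonglongrightarrow> prob (\<Inter>m. ?A m)"
  proof (rule finite_Lim_measure_decseq)
    show "decseq ?A"
      by (rule decseq_SucI) (auto, metis enat_ord_simps(1) le_SucI order_refl order_trans)
  qed auto
  moreover have "prob (\<Inter>m. ?A m) = prob {}"
  proof (rule finite_measure_eq_AE)
    show "AE \<omega> in M. \<omega> \<in> (\<Inter>m. ?A m) \<longleftrightarrow> \<omega> \<in> {}"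
      using assms
    proof eventually_elim
      case (elim \<omega>)
      then obtain k where "\<tau> \<omega> = enat k" by auto
      then show ?case by auto
    qed
  qed auto
  ultimately show ?thesis by simp
qed

text \<open>Given a cylinder on which \<open>\<tau>\<close> has not occurred, uniform integrability makes the position of
  the walk the conditional mean of its final value.\<close>

lemma UI_walk_bounded:
  assumes fin: "AE \<omega> in M. \<tau> \<omega> \<noteq> \<infinity>"
    and bound: "AE \<omega> in M. \<bar>value_at (walk \<xi>) \<tau> \<omega>\<bar> \<le> 2"
    and UI: "uniformly_integrable M Y"
    and s: "set s \<subseteq> {1, -1}" "\<And>\<omega>. \<omega> \<in> cylinder s \<Longrightarrow> enat (length s) \<le> \<tau> \<omega>"
  shows "\<bar>sum_list s\<bar> \<le> 2"
proof -
  let ?C = "cylinder s" and ?x = "real_of_int (sum_list s)" and ?n = "length s"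
  have "\<bar>?x\<bar> * prob ?C \<le> 2 * prob ?C + \<epsilon>" if "\<epsilon> > 0" for \<epsilon> :: real
  proof -
    obtain K where K: "\<And>m. (\<integral>\<omega>. \<bar>Y m \<omega>\<bar> * indicator {\<omega>. \<bar>Y m \<omega>\<bar> > K} \<omega> \<partial>M) \<le> \<epsilon>"
      using UI \<open>\<epsilon> > 0\<close> unfolding uniformly_integrable_def by blast
    let ?N = "\<lambda>m. {\<omega> \<in> space M. \<not> \<tau> \<omega> \<le> enat m}"
    have "\<bar>?x\<bar> * prob ?C \<le> 2 * prob ?C + \<epsilon> + \<bar>K\<bar> * prob (?N m)" if "m \<ge> ?n" for m
    proof -
      let ?g = "\<lambda>\<omega>. \<bar>Y m \<omega>\<bar> * indicator {\<omega>. \<bar>Y m \<omega>\<bar> > K} \<omega>"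
      have g: "integrable M ?g"
      proof (rule Bochner_Integration.integrable_bound[OF integrable_stopped[of m]])
        show "?g \<in> borel_measurable M" unfolding indicator_def by measurable
      qed (auto simp: indicator_def)
      have C: "integrable M (\<lambda>\<omega>. indicator ?C \<omega> * Y k \<omega>)" for k
        using integrable_real_mult_indicator[OF cylinder_sets integrable_stopped[of k]]
        by (simp add: mult.commute)
      have "\<bar>?x\<bar> * prob ?C = \<bar>\<integral>\<omega>. indicator ?C \<omega> * ?x \<partial>M\<bar>"
        by (simp add: abs_mult)
      also have "(\<integral>\<omega>. indicator ?C \<omega> * ?x \<partial>M) = (\<integral>\<omega>. indicator ?C \<omega> * Y ?n \<omega> \<partial>M)"
      proof (rule Bochner_Integration.integral_cong)
        fix \<omega> show "indicator ?C \<omega> * ?x = indicator ?C \<omega> * Y ?n \<omega>"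
        proof (cases "\<omega> \<in> ?C")
          case True
          then show ?thesis using s(2)[OF True]
            by (simp add: stopped_not_stopped walk_eq_sum_list cylinder_def)
        qed simp
      qed simp
      also have "\<dots> = (\<integral>\<omega>. indicator ?C \<omega> * Y m \<omega> \<partial>M)"
        using integral_stopped[OF cylinder_filtration \<open>m \<ge> ?n\<close>] by simp
      also have "\<bar>\<dots>\<bar> \<le> (\<integral>\<omega>. \<bar>indicator ?C \<omega> * Y m \<omega>\<bar> \<partial>M)"
        by (rule integral_abs_bound)
      \<comment> \<open>There are three cases on the cylinder: a stopped path has value at most 2;
        an unstopped one beyond \<open>K\<close> is covered by \<open>?g\<close>; an unstopped one
        within \<open>K\<close> costs \<open>\<bar>K\<bar>\<close> on an event whose probability
        tends to 0. The absolute value keeps the last term nonnegative should \<open>K\<close> be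
        negative.\<close>
      also have "\<dots> \<le> (\<integral>\<omega>. 2 * indicator ?C \<omega> + ?g \<omega> + \<bar>K\<bar> * indicator (?N m) \<omega> \<partial>M)"
      proof (rule integral_mono_AE)
        show "integrable M (\<lambda>\<omega>. \<bar>indicator ?C \<omega> * Y m \<omega>\<bar>)"
          using C by (rule integrable_abs)
        show "integrable M (\<lambda>\<omega>. 2 * indicator ?C \<omega> + ?g \<omega> + \<bar>K\<bar> * indicator (?N m) \<omega>)"
          using g by (intro Bochner_Integration.integrable_add integrable_mult_right integrable_real_indicator)
            (auto simp: emeasure_eq_measure)
        show "AE \<omega> in M. \<bar>indicator ?C \<omega> * Y m \<omega>\<bar>
            \<le> 2 * indicator ?C \<omega> + ?g \<omega> + \<bar>K\<bar> * indicator (?N m) \<omega>"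
          using bound AE_space
        proof eventually_elim
          case (elim \<omega>)
          show ?case
          proof (cases "\<tau> \<omega> \<le> enat m")
            case True
            then have "\<bar>Y m \<omega>\<bar> \<le> 2" using elim by (simp add: stopped_stopped)
            then show ?thesis by (auto simp: indicator_def)
          next
            case False
            then show ?thesis using elim by (auto simp: indicator_def)
          qed
        qed
      qed
      also have "\<dots> = 2 * prob ?C + (\<integral>\<omega>. ?g \<omega> \<partial>M) + \<bar>K\<bar> * prob (?N m)"
      proof -
        have "integrable M (indicator A :: 'a \<Rightarrow> real)" if "A \<in> sets M" for A
          using that by (simp add: integrable_real_indicator emeasure_eq_measure)
        then show ?thesis using g by simp
      qed
      finally show ?thesis using K[of m] by linarith
    qed
    moreover have "(\<lambda>m. 2 * prob ?C + \<epsilon> + \<bar>K\<bar> * prob (?N m)) \<longlonglongrightarrow> 2 * prob ?C + \<epsilon> + \<bar>K\<bar> * 0"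
      by (intro tendsto_intros prob_not_stopped_tendsto fin)
    ultimately show ?thesis
      by (intro LIMSEQ_le_const[of "\<lambda>m. 2 * prob ?C + \<epsilon> + \<bar>K\<bar> * prob (?N m)"]) auto
  qed
  then have "\<bar>?x\<bar> * prob ?C \<le> 2 * prob ?C" by (rule field_le_epsilon)
  moreover have "prob ?C > 0" by (simp add: prob_cylinder[OF s(1)])
  ultimately have "\<bar>?x\<bar> \<le> 2" by simp
  then show ?thesis by linarith
qed

text \<open>One outcome suffices, since whether \<open>\<tau>\<close> equals
  \<open>2 * length s\<close> is decided by the history up to that time and hence is constant on the
  cylinder.\<close>

definition stops :: "int list \<Rightarrow> bool" where
  "stops s \<longleftrightarrow> (\<exists>\<omega>\<in>cylinder (excursions s). \<tau> \<omega> = enat (2 * length s))"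

lemma stops_cylinder:
  assumes "stops s" "\<omega> \<in> cylinder (excursions s)"
  shows "\<tau> \<omega> = enat (2 * length s)"
  using assms stopping_determined_eq[of _ "excursions s" \<omega> "2 * length s"] by (auto simp: stops_def)

lemma stops_prefix_free:
  assumes "stops s" "stops (s @ t)"
  shows "t = []"
proof -
  obtain \<omega> where \<omega>: "\<omega> \<in> cylinder (excursions (s @ t))" "\<tau> \<omega> = enat (2 * length (s @ t))"
    using assms(2) by (auto simp: stops_def)
  then have "\<omega> \<in> cylinder (excursions s)"
    using cylinder_append[of "excursions s" "excursions t"] by (auto simp: excursions_append)
  then show ?thesis using stops_cylinder[OF assms(1)] \<omega>(2) by simp
qed

lemma UI_value_zero_iff:
  assumes fin: "AE \<omega> in M. \<tau> \<omega> \<noteq> \<infinity>"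
    and bound: "AE \<omega> in M. \<bar>value_at (walk \<xi>) \<tau> \<omega>\<bar> \<le> 2"
    and UI: "uniformly_integrable M Y"
  shows "AE \<omega> in M. value_at (walk \<xi>) \<tau> \<omega> = 0 \<longleftrightarrow>
    (\<exists>n. \<exists>s\<in>sign_words n. stops s \<and> \<omega> \<in> cylinder (excursions s))"
  using fin AE_steps AE_space
proof eventually_elim
  case (elim \<omega>)
  show ?case
  proof
    assume "\<exists>n. \<exists>s\<in>sign_words n. stops s \<and> \<omega> \<in> cylinder (excursions s)"
    then obtain s where s: "stops s" "\<omega> \<in> cylinder (excursions s)" by blast
    then show "value_at (walk \<xi>) \<tau> \<omega> = 0"
      using stops_cylinder[OF s] by (simp add: value_at_def walk_eq_sum_list cylinder_def)
  next
    assume zero: "value_at (walk \<xi>) \<tau> \<omega> = 0"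
    obtain m where m: "\<tau> \<omega> = enat m" using elim by auto
    have walk_m: "walk \<xi> m \<omega> = 0" using zero m by (simp add: value_at_def)
    then obtain n where n: "m = 2 * n" using even_walk_iff[of \<xi> \<omega> m, OF elim(2)] by auto
    have steps: "\<xi> (Suc i) \<omega> \<in> {1, -1}" for i using elim(2) by simp
    \<comment> \<open>An unstopped path can still step either way, and \<open>\<tau>\<close> is at
      least the new time on both extended cylinders. So both neighbours of the current position obey
      the bound 2; this leaves 1 for the position, and parity then gives 0 at even times.\<close>
    have le1: "\<bar>walk \<xi> k \<omega>\<bar> \<le> 1" if "k < m" for k
    proof -
      let ?h = "history \<xi> k \<omega>"
      have "\<bar>sum_list (?h @ [e])\<bar> \<le> 2" if e: "e \<in> {1, -1}" for e
      proof (rule UI_walk_bounded[OF fin bound UI])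
        show "set (?h @ [e]) \<subseteq> {1, -1}" using steps e by (auto simp: history_def)
        fix \<omega>' assume "\<omega>' \<in> cylinder (?h @ [e])"
        then have "\<omega>' \<in> cylinder ?h" using cylinder_append by blast
        moreover have "\<omega> \<in> cylinder ?h" using elim by (simp add: cylinder_def)
        ultimately have "\<not> \<tau> \<omega>' \<le> enat k"
          using stopping_determined[of \<omega> ?h \<omega>' k] m \<open>k < m\<close> by simp
        then show "enat (length (?h @ [e])) \<le> \<tau> \<omega>'" by (cases "\<tau> \<omega>'") simp_all
      qed
      from this[of 1] this[of "-1"] show ?thesis by (simp add: walk_eq_sum_list)
    qed
    have "walk \<xi> (2 * j) \<omega> = 0" if "j \<le> n" for j
    proof (cases "j = n")
      case False
      then have "\<bar>walk \<xi> (2 * j) \<omega>\<bar> \<le> 1" using that by (intro le1) (simp add: n)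
      moreover have "even (walk \<xi> (2 * j) \<omega>)" using even_walk_iff[of \<xi> \<omega> "2 * j", OF elim(2)] by simp
      ultimately show ?thesis by presburger
    qed (use walk_m n in simp)
    then have h: "history \<xi> m \<omega> = excursions (map (\<lambda>j. \<xi> (Suc (2 * j)) \<omega>) [0..<n])"
      unfolding n by (rule history_excursions)
    let ?s = "map (\<lambda>j. \<xi> (Suc (2 * j)) \<omega>) [0..<n]"
    have "?s \<in> sign_words n" using steps by (auto simp: sign_words_def)
    moreover have "\<omega> \<in> cylinder (excursions ?s)"
      using h elim by (simp add: cylinder_def n)
    moreover from this have "stops ?s" unfolding stops_def using m n by auto
    ultimately show "\<exists>n. \<exists>s\<in>sign_words n. stops s \<and> \<omega> \<in> cylinder (excursions s)" by blast
  qed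
qed

lemma prob_UN_excursions:
  assumes "S \<subseteq> sign_words n"
  shows "prob (\<Union>s\<in>S. cylinder (excursions s)) = real (card S) / 4 ^ n"
proof -
  have fin: "finite S" using assms finite_sign_words finite_subset by blast
  have inj: "inj_on excursions S" using inj_excursions by (rule inj_on_subset) simp
  have len: "length s = n" "set s \<subseteq> {1, -1}" if "s \<in> S" for s
    using that assms by (auto simp: sign_words_def)
  have "prob (\<Union>s\<in>excursions ` S. cylinder s) = (\<Sum>s\<in>excursions ` S. 1 / 2 ^ length s)"
  proof (rule prob_UN_cylinder)
    show "cylinder s \<inter> cylinder t = {}" if "s \<in> excursions ` S" "t \<in> excursions ` S" "s \<noteq> t" for s t
      using that len by (intro cylinder_disjoint) auto
    show "set s \<subseteq> {1, -1}" if "s \<in> excursions ` S" for s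
      using that len(2) set_excursions by blast
  qed (simp add: fin)
  also have "\<dots> = (\<Sum>s\<in>S. 1 / 4 ^ n)"
    using len by (subst sum.reindex[OF inj]) (simp add: power_mult)
  finally show ?thesis by simp
qed

lemma UI_prob_value_zero:
  assumes "AE \<omega> in M. \<tau> \<omega> \<noteq> \<infinity>"
    and "AE \<omega> in M. \<bar>value_at (walk \<xi>) \<tau> \<omega>\<bar> \<le> 2"
    and "uniformly_integrable M Y"
  shows "prob {\<omega> \<in> space M. value_at (walk \<xi>) \<tau> \<omega> = 0} \<in> kraft_values"
proof (rule kraft_valuesI[where b = "\<lambda>n. card {s \<in> sign_words n. stops s}"])
  show "(\<Sum>n\<le>N. real (card {s \<in> sign_words n. stops s}) / 2 ^ n) \<le> 1" for N
    by (rule kraft_inequality) (rule stops_prefix_free)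
  define E where "E n = (\<Union>s\<in>{s \<in> sign_words n. stops s}. cylinder (excursions s))" for n
  have [measurable]: "E n \<in> sets M" for n unfolding E_def by (intro sets.finite_UN) auto
  have prob_E: "prob (E n) = real (card {s \<in> sign_words n. stops s}) / 4 ^ n" for n
    unfolding E_def by (rule prob_UN_excursions) auto
  have "disjoint_family E"
  proof -
    have "\<tau> \<omega> = enat (2 * n)" if "\<omega> \<in> E n" for \<omega> n
      using that stops_cylinder by (auto simp: E_def sign_words_def)
    then have "m = n" if "\<omega> \<in> E m" "\<omega> \<in> E n" for \<omega> m n
      using that by (metis enat.inject mult_cancel1 zero_neq_numeral)
    then show ?thesis unfolding disjoint_family_on_def by blast
  qed
  then have "(\<lambda>n. prob (E n)) sums prob (\<Union>n. E n)"
    by (intro finite_measure_UNION) auto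
  also have "prob (\<Union>n. E n) = prob {\<omega> \<in> space M. value_at (walk \<xi>) \<tau> \<omega> = 0}"
    using UI_value_zero_iff[OF assms] AE_space
    by (intro finite_measure_eq_AE) (auto simp: E_def elim!: eventually_rev_mp)
  finally show "(\<lambda>n. real (card {s \<in> sign_words n. stops s}) / 4 ^ n)
      sums prob {\<omega> \<in> space M. value_at (walk \<xi>) \<tau> \<omega> = 0}"
    by (simp add: prob_E)
qed

end

lemma (in simple_symmetric_random_walk) UI_embeddable_kraft_values:
  assumes "\<mu> \<in> UI_embeddable M (walk \<xi>)" "set_pmf \<mu> \<subseteq> {-2, 0, 2}"
  shows "pmf \<mu> 0 \<in> kraft_values"
proof -
  obtain \<tau> where \<tau>: "stopping_time (natural_filtration M (walk \<xi>)) \<tau>" "AE \<omega> in M. \<tau> \<omega> \<noteq> \<infinity>"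
    "distr M (count_space UNIV) (value_at (walk \<xi>) \<tau>) = measure_pmf \<mu>"
    "uniformly_integrable M (\<lambda>n \<omega>. real_of_int (stopped (walk \<xi>) \<tau> n \<omega>))"
    using assms(1) unfolding UI_embeddable_def by blast
  interpret stopped_walk M \<xi> \<tau> by standard (rule \<tau>(1))
  have "AE x in distr M (count_space UNIV) (value_at (walk \<xi>) \<tau>). \<bar>x\<bar> \<le> 2"
    unfolding \<tau>(3) using assms(2) by (auto simp: AE_measure_pmf_iff)
  then have "AE \<omega> in M. \<bar>value_at (walk \<xi>) \<tau> \<omega>\<bar> \<le> 2"
    by (subst (asm) AE_distr_iff) auto
  then have "prob {\<omega> \<in> space M. value_at (walk \<xi>) \<tau> \<omega> = 0} \<in> kraft_values"
    by (rule UI_prob_value_zero[OF \<tau>(2) _ \<tau>(4)])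
  also have "prob {\<omega> \<in> space M. value_at (walk \<xi>) \<tau> \<omega> = 0} =
      measure (distr M (count_space UNIV) (value_at (walk \<xi>) \<tau>)) {0}"
    by (subst measure_distr) (auto simp: vimage_def Int_def conj_commute)
  finally show ?thesis by (simp add: \<tau>(3) measure_pmf_single)
qed

subsection \<open>Kraft sums yield uniformly integrable stopping times\<close>

text \<open>Any choice serves, because only cardinalities enter the probabilities. It is meaningful
  only if \<open>A\<close> has \<open>k\<close> elements to offer, which
  \<open>card_pending_words\<close> ensures under the Kraft bound.\<close>

definition pick :: "nat \<Rightarrow> 'a set \<Rightarrow> 'a set" where
  "pick k A = (SOME B. B \<subseteq> A \<and> card B = k)"

lemma pick:
  assumes "k \<le> card A"
  shows "pick k A \<subseteq> A" "card (pick k A) = k"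
proof -
  have "\<exists>B. B \<subseteq> A \<and> card B = k" using obtain_subset_with_card_n[OF assms] by metis
  then have "pick k A \<subseteq> A \<and> card (pick k A) = k" unfolding pick_def by (rule someI_ex)
  then show "pick k A \<subseteq> A" "card (pick k A) = k" by simp_all
qed

text \<open>The words of length \<open>n\<close> without a selected proper prefix; \<open>b n\<close> of them are selected.\<close>

primrec pending_words :: "(nat \<Rightarrow> nat) \<Rightarrow> nat \<Rightarrow> int list set" where
  "pending_words b 0 = {[]}"
| "pending_words b (Suc n) =
    (\<lambda>(s, e). s @ [e]) ` ((pending_words b n - pick (b n) (pending_words b n)) \<times> {1, -1})"

abbreviation stopped_words :: "(nat \<Rightarrow> nat) \<Rightarrow> nat \<Rightarrow> int list set" where
  "stopped_words b n \<equiv> pick (b n) (pending_words b n)"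

lemma pending_words_subset: "pending_words b n \<subseteq> sign_words n"
proof (induction n)
  case (Suc n)
  then show ?case by (auto simp: sign_words_Suc_append)
qed (simp add: sign_words_def)

lemma finite_pending_words [simp]: "finite (pending_words b n)"
  using pending_words_subset finite_sign_words by (rule finite_subset)

lemma take_pending_words:
  assumes "s \<in> pending_words b n" "j < n"
  shows "take j s \<in> pending_words b j - stopped_words b j"
  using assms
proof (induction n arbitrary: s)
  case (Suc n)
  then obtain t e where s: "s = t @ [e]" and t: "t \<in> pending_words b n - stopped_words b n" by auto
  have len: "length t = n" using t pending_words_subset[of b n] by (auto simp: sign_words_def)
  show ?case
  proof (cases "j = n")
    case True
    then show ?thesis using s t len by simp
  next
    case False
    then show ?thesis using Suc.IH[of t] Suc.prems s t len by simp
  qed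
qed simp

text \<open>Pending weight plus spent weight stays 1, since a continuing word has two children of
  half its weight. The two claims feed each other: the identity at \<open>n\<close> leaves enough
  words to select, and this gives the identity at \<open>Suc n\<close>.\<close>

lemma card_pending_words:
  assumes kraft: "\<And>N. (\<Sum>n\<le>N. real (b n) / 2 ^ n) \<le> 1"
  shows "real (card (pending_words b n)) / 2 ^ n + (\<Sum>i<n. real (b i) / 2 ^ i) = 1"
    and "b n \<le> card (pending_words b n)"
proof -
  have le: "b n \<le> card (pending_words b n)"
    if "real (card (pending_words b n)) / 2 ^ n + (\<Sum>i<n. real (b i) / 2 ^ i) = 1" for n
  proof -
    have "real (b n) / 2 ^ n \<le> real (card (pending_words b n)) / 2 ^ n"
      using that kraft[of n] by (simp flip: lessThan_Suc_atMost)
    then show ?thesis by (simp add: divide_le_cancel)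
  qed
  show "real (card (pending_words b n)) / 2 ^ n + (\<Sum>i<n. real (b i) / 2 ^ i) = 1"
  proof (induction n)
    case (Suc n)
    note b = pick[OF le[OF Suc]]
    have "card (pending_words b (Suc n)) = card ((pending_words b n - stopped_words b n) \<times> {1, -1 :: int})"
      unfolding pending_words.simps by (rule card_image) (auto simp: inj_on_def)
    also have "\<dots> = (card (pending_words b n) - b n) * 2"
      using b by (subst card_cartesian_product) (simp add: card_Diff_subset finite_subset[OF b(1)])
    finally have "real (card (pending_words b (Suc n))) = (real (card (pending_words b n)) - real (b n)) * 2"
      using le[OF Suc] by (simp add: of_nat_diff)
    then show ?case using Suc by (simp add: diff_divide_distrib)
  qed simp
  then show "b n \<le> card (pending_words b n)" by (rule le)
qed

context simple_symmetric_random_walk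
begin

definition continues :: "(nat \<Rightarrow> nat) \<Rightarrow> nat \<Rightarrow> 'a \<Rightarrow> bool" where
  "continues b n \<omega> \<longleftrightarrow> history \<xi> (2 * n) \<omega> \<in> excursions ` (pending_words b n - stopped_words b n)"

text \<open>Only even times are candidates. The infimum of the empty set is
  \<open>\<infinity>\<close>, so a path that always continues never stops.\<close>

definition embedding_time :: "(nat \<Rightarrow> nat) \<Rightarrow> 'a \<Rightarrow> enat" where
  "embedding_time b \<omega> = (INF n\<in>{n. \<not> continues b n \<omega>}. enat (2 * n))"

lemma embedding_time_le_iff: "embedding_time b \<omega> \<le> enat m \<longleftrightarrow> (\<exists>n. 2 * n \<le> m \<and> \<not> continues b n \<omega>)"
proof
  assume le: "embedding_time b \<omega> \<le> enat m"
  show "\<exists>n. 2 * n \<le> m \<and> \<not> continues b n \<omega>"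
  proof (rule ccontr)
    assume "\<not> ?thesis"
    then have "enat (Suc m) \<le> embedding_time b \<omega>"
      unfolding embedding_time_def by (intro INF_greatest) (auto simp: Suc_le_eq not_le)
    then have "enat (Suc m) \<le> enat m" using le by (rule order_trans)
    then show False by simp
  qed
next
  assume "\<exists>n. 2 * n \<le> m \<and> \<not> continues b n \<omega>"
  then obtain n where "2 * n \<le> m" "\<not> continues b n \<omega>" by blast
  then show "embedding_time b \<omega> \<le> enat m"
    unfolding embedding_time_def by (intro INF_lower2[of n]) auto
qed

lemma stopping_time_embedding_time:
  "stopping_time (natural_filtration M (walk \<xi>)) (embedding_time b)"
proof
  fix t
  show "Measurable.pred (natural_filtration M (walk \<xi>) t) (\<lambda>\<omega>. embedding_time b \<omega> \<le> t)"
  proof (cases t)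
    case (enat m)
    have "Measurable.pred (\<F> m) (continues b n)" if "2 * n \<le> m" for n
    proof -
      have "Measurable.pred (\<F> (2 * n)) (continues b n)"
        unfolding continues_def by (rule pred_history_natural_filtration)
      moreover have "measurable (\<F> (2 * n)) (count_space UNIV :: bool measure) \<subseteq> measurable (\<F> m) (count_space UNIV)"
        using that by (intro measurable_mono sets_natural_filtration_mono) auto
      ultimately show ?thesis by blast
    qed
    then have "Measurable.pred (\<F> m) (\<lambda>\<omega>. \<exists>n\<in>{n. 2 * n \<le> m}. \<not> continues b n \<omega>)"
      by (intro pred_intros_countable_bounded pred_intros_logic) auto
    then show ?thesis unfolding enat embedding_time_le_iff Bex_def mem_Collect_eq .
  qed simp
qed

end

locale kraft_embedding = simple_symmetric_random_walk +
  fixes b :: "nat \<Rightarrow> nat"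
  assumes kraft: "\<And>N. (\<Sum>n\<le>N. real (b n) / 2 ^ n) \<le> 1"
begin

sublocale stopped_walk M \<xi> "embedding_time b"
  by standard (rule stopping_time_embedding_time)

lemmas stopped_words = pick[OF card_pending_words(2)[OF kraft]]

lemma prob_UN_stopped_words:
  "prob (\<Union>s\<in>stopped_words b n. cylinder (excursions s)) = real (b n) / 4 ^ n"
  using subset_trans[OF stopped_words(1) pending_words_subset]
  by (subst prob_UN_excursions[where n = n]) (simp_all add: stopped_words(2))

text \<open>Never stopping requires \<open>n\<close> complete excursions for every \<open>n\<close>;
  there are at most \<open>2 ^ n\<close> sign words for them, each of probability
  \<open>1 / 4 ^ n\<close>.\<close>

lemma AE_embedding_time_finite: "AE \<omega> in M. embedding_time b \<omega> \<noteq> \<infinity>"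
proof -
  have "prob {\<omega> \<in> space M. embedding_time b \<omega> = \<infinity>} \<le> (1/2) ^ n" for n
  proof -
    have "{\<omega> \<in> space M. embedding_time b \<omega> = \<infinity>} \<subseteq> (\<Union>s\<in>pending_words b n. cylinder (excursions s))"
    proof
      fix \<omega> assume \<omega>: "\<omega> \<in> {\<omega> \<in> space M. embedding_time b \<omega> = \<infinity>}"
      then have "\<not> embedding_time b \<omega> \<le> enat (2 * n)" by simp
      then have "continues b n \<omega>" by (auto simp: embedding_time_le_iff)
      then obtain s where s: "history \<xi> (2 * n) \<omega> = excursions s" "s \<in> pending_words b n"
        by (auto simp: continues_def)
      moreover from this have "length (excursions s) = 2 * n" by (metis length_history)
      ultimately show "\<omega> \<in> (\<Union>s\<in>pending_words b n. cylinder (excursions s))"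
        using \<omega> by (auto simp: cylinder_def)
    qed
    then have "prob {\<omega> \<in> space M. embedding_time b \<omega> = \<infinity>}
        \<le> prob (\<Union>s\<in>pending_words b n. cylinder (excursions s))"
      by (rule finite_measure_mono) (intro sets.finite_UN, auto)
    also have "\<dots> = real (card (pending_words b n)) / 4 ^ n"
      by (rule prob_UN_excursions) (rule pending_words_subset)
    also have "\<dots> \<le> 2 ^ n / 4 ^ n"
      using card_mono[OF finite_sign_words pending_words_subset, of b n]
      by (intro divide_right_mono) (simp_all add: card_sign_words flip: of_nat_le_iff)
    also have "\<dots> = (1/2) ^ n" by (simp flip: power_divide)
    finally show ?thesis .
  qed
  moreover have "(\<lambda>n. (1/2 :: real) ^ n) \<longlonglongrightarrow> 0" by (rule LIMSEQ_power_zero) simp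
  ultimately have "prob {\<omega> \<in> space M. embedding_time b \<omega> = \<infinity>} \<le> 0"
    by (intro LIMSEQ_le_const) auto
  then have "prob {\<omega> \<in> space M. embedding_time b \<omega> = \<infinity>} = 0"
    by (simp only: measure_le_0_iff)
  then have "AE \<omega> in M. \<not> \<omega> \<in> {\<omega> \<in> space M. embedding_time b \<omega> = \<infinity>}"
    by (subst (asm) prob_eq_0) auto
  then show ?thesis using AE_space by eventually_elim auto
qed

lemma continuesD: "continues b n \<omega> \<Longrightarrow> walk \<xi> (2 * n) \<omega> = 0"
  by (auto simp: continues_def walk_eq_sum_list)

text \<open>A pending word has no selected proper prefix, so all earlier tests succeed; injectivity
  of \<open>excursions\<close> makes the test at \<open>n\<close> fail.\<close>

lemma embedding_time_stopped_words:
  assumes "s \<in> stopped_words b n" "\<omega> \<in> cylinder (excursions s)"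
  shows "embedding_time b \<omega> = enat (2 * n)"
proof -
  have s: "s \<in> pending_words b n" using assms(1) stopped_words by blast
  then have len: "length s = n" using pending_words_subset[of b n] by (auto simp: sign_words_def)
  have h: "history \<xi> (2 * n) \<omega> = excursions s" using assms(2) len by (simp add: cylinder_def)
  have "\<not> continues b n \<omega>"
    using assms(1) injD[OF inj_excursions] by (auto simp: continues_def h)
  moreover have "continues b j \<omega>" if "j < n" for j
  proof -
    have "excursions s = excursions (take j s) @ excursions (drop j s)"
      by (simp flip: excursions_append)
    moreover have "length (excursions (take j s)) = 2 * j" using that len by simp
    ultimately have "take (2 * j) (excursions s) = excursions (take j s)"
      by (metis append_eq_conv_conj)
    moreover have "history \<xi> (2 * j) \<omega> = take (2 * j) (history \<xi> (2 * n) \<omega>)"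
      using that by (simp add: take_history min_def)
    ultimately show ?thesis
      using take_pending_words[OF s that] by (simp add: continues_def h)
  qed
  ultimately have "embedding_time b \<omega> \<le> enat m \<longleftrightarrow> 2 * n \<le> m" for m
    unfolding embedding_time_le_iff by (metis linorder_not_less mult_le_mono2 order_trans)
  then show ?thesis
    by (metis enat_ord_simps(1) enat_ile order_antisym order_refl)
qed

text \<open>Before the first failure the path consists of complete excursions. Two equal further
  steps lead to -2 or 2; two opposite ones extend the sign word to a pending word, and failure then
  means that it is selected.\<close>

lemma embedding_time_cases:
  assumes "\<forall>k\<ge>1. \<xi> k \<omega> \<in> {1, -1}" "\<omega> \<in> space M" "embedding_time b \<omega> \<noteq> \<infinity>"
  shows "value_at (walk \<xi>) (embedding_time b) \<omega> \<in> {-2, 2} \<or>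
    value_at (walk \<xi>) (embedding_time b) \<omega> = 0 \<and>
    (\<exists>n. \<exists>s\<in>stopped_words b n. \<omega> \<in> cylinder (excursions s))"
proof -
  obtain m where m: "embedding_time b \<omega> = enat m" using assms(3) by auto
  then obtain n where n: "2 * n \<le> m" "\<not> continues b n \<omega>"
    using embedding_time_le_iff[of b \<omega> m] by auto
  have "embedding_time b \<omega> \<le> enat (2 * n)" using n by (auto simp: embedding_time_le_iff)
  then have mn: "m = 2 * n" using n m by simp
  have cont: "continues b j \<omega>" if "j < n" for j
  proof (rule ccontr)
    assume "\<not> continues b j \<omega>"
    then have "embedding_time b \<omega> \<le> enat (2 * j)" by (auto simp: embedding_time_le_iff)
    then show False using m mn that by simp
  qed
  have val: "value_at (walk \<xi>) (embedding_time b) \<omega> = walk \<xi> (2 * n) \<omega>"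
    by (simp add: value_at_def m mn)
  have stop: ?thesis if "history \<xi> (2 * n) \<omega> = excursions s" "s \<in> pending_words b n" for s
  proof -
    have "s \<in> stopped_words b n" using n(2) that by (auto simp: continues_def)
    moreover have "length s = n" using that(2) pending_words_subset[of b n] by (auto simp: sign_words_def)
    then have "\<omega> \<in> cylinder (excursions s)" using that(1) assms(2) by (simp add: cylinder_def)
    moreover have "walk \<xi> (2 * n) \<omega> = 0" using that(1) by (simp add: walk_eq_sum_list)
    ultimately show ?thesis using val by auto
  qed
  show ?thesis
  proof (cases n)
    case 0
    then show ?thesis using stop[of "[]"] by simp
  next
    case (Suc k)
    let ?x = "\<xi> (Suc (2 * k)) \<omega>" and ?y = "\<xi> (Suc (Suc (2 * k))) \<omega>"
    have xy: "?x \<in> {1, -1}" "?y \<in> {1, -1}" using assms(1) by simp_all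
    have k: "continues b k \<omega>" using cont[of k] Suc by simp
    show ?thesis
    proof (cases "?y = - ?x")
      case True
      obtain s where s: "history \<xi> (2 * k) \<omega> = excursions s" "s \<in> pending_words b k - stopped_words b k"
        using k by (auto simp: continues_def)
      have "history \<xi> (2 * n) \<omega> = excursions (s @ [?x])"
        using s(1) True by (simp add: Suc history_Suc excursions_append excursions_Cons)
      moreover have "s @ [?x] \<in> pending_words b n" using s(2) xy(1) by (auto simp: Suc)
      ultimately show ?thesis by (rule stop)
    next
      case False
      then have "walk \<xi> (2 * n) \<omega> \<in> {-2, 2}" using xy continuesD[OF k] by (auto simp: Suc walk_Suc)
      then show ?thesis using val by simp
    qed
  qed
qed

lemma value_zero_iff:
  assumes "\<forall>k\<ge>1. \<xi> k \<omega> \<in> {1, -1}" "\<omega> \<in> space M" "embedding_time b \<omega> \<noteq> \<infinity>"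
  shows "value_at (walk \<xi>) (embedding_time b) \<omega> = 0 \<longleftrightarrow>
    (\<exists>n. \<exists>s\<in>stopped_words b n. \<omega> \<in> cylinder (excursions s))"
proof
  assume "\<exists>n. \<exists>s\<in>stopped_words b n. \<omega> \<in> cylinder (excursions s)"
  then obtain n s where s: "s \<in> stopped_words b n" "\<omega> \<in> cylinder (excursions s)" by blast
  have "length s = n" using s(1) stopped_words pending_words_subset[of b n] by (auto simp: sign_words_def)
  then show "value_at (walk \<xi>) (embedding_time b) \<omega> = 0"
    using embedding_time_stopped_words[OF s] s(2) by (simp add: value_at_def walk_eq_sum_list cylinder_def)
qed (use embedding_time_cases[OF assms] in auto)

lemma AE_value_at: "AE \<omega> in M. value_at (walk \<xi>) (embedding_time b) \<omega> \<in> {-2, 0, 2}"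
  using AE_steps AE_space AE_embedding_time_finite
  by eventually_elim (use embedding_time_cases in blast)

lemma prob_value_zero:
  assumes "(\<lambda>n. real (b n) / 4 ^ n) sums p"
  shows "prob {\<omega> \<in> space M. value_at (walk \<xi>) (embedding_time b) \<omega> = 0} = p"
proof -
  define E where "E n = (\<Union>s\<in>stopped_words b n. cylinder (excursions s))" for n
  have [measurable]: "E n \<in> sets M" for n
    unfolding E_def using finite_subset[OF stopped_words(1)] by (intro sets.finite_UN) auto
  have "\<omega> \<in> E n \<Longrightarrow> embedding_time b \<omega> = enat (2 * n)" for \<omega> n
    using embedding_time_stopped_words by (auto simp: E_def)
  then have "m = n" if "\<omega> \<in> E m" "\<omega> \<in> E n" for \<omega> m n
    using that by (metis enat.inject mult_cancel1 zero_neq_numeral)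
  then have "disjoint_family E" unfolding disjoint_family_on_def by blast
  then have "(\<lambda>n. prob (E n)) sums prob (\<Union>n. E n)"
    by (intro finite_measure_UNION) auto
  moreover have "prob (E n) = real (b n) / 4 ^ n" for n
    unfolding E_def by (rule prob_UN_stopped_words)
  ultimately have "prob (\<Union>n. E n) = p" using assms sums_unique2 by simp
  moreover have "prob {\<omega> \<in> space M. value_at (walk \<xi>) (embedding_time b) \<omega> = 0} = prob (\<Union>n. E n)"
  proof (rule finite_measure_eq_AE)
    show "AE \<omega> in M. \<omega> \<in> {\<omega> \<in> space M. value_at (walk \<xi>) (embedding_time b) \<omega> = 0} \<longleftrightarrow> \<omega> \<in> (\<Union>n. E n)"
      using AE_steps AE_space AE_embedding_time_finite
      by eventually_elim (auto simp: E_def value_zero_iff)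
  qed auto
  ultimately show ?thesis by simp
qed

text \<open>Before stopping, the walk is at 0 at even times and thus within 1 at odd times; distance
  2 occurs only on stopping.\<close>

lemma AE_stopped_bounded: "AE \<omega> in M. \<forall>n. \<bar>stopped (walk \<xi>) (embedding_time b) n \<omega>\<bar> \<le> 2"
  using AE_steps AE_value_at
proof eventually_elim
  case (elim \<omega>)
  show ?case
  proof
    fix n
    show "\<bar>stopped (walk \<xi>) (embedding_time b) n \<omega>\<bar> \<le> 2"
    proof (cases "embedding_time b \<omega> \<le> enat n")
      case True
      then show ?thesis using elim(2) by (auto simp: stopped_stopped)
    next
      case False
      then have eq: "stopped (walk \<xi>) (embedding_time b) n \<omega> = walk \<xi> n \<omega>"
        by (intro stopped_not_stopped) simp
      have "continues b (n div 2) \<omega>" using False by (auto simp: embedding_time_le_iff)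
      then have 0: "walk \<xi> (2 * (n div 2)) \<omega> = 0" by (rule continuesD)
      show ?thesis
      proof (cases "even n")
        case True
        then show ?thesis using 0 eq by simp
      next
        case False
        then have "n = Suc (2 * (n div 2))" by simp
        then have "walk \<xi> n \<omega> = \<xi> n \<omega>" using 0 walk_Suc[of \<xi> "2 * (n div 2)" \<omega>] by simp
        moreover have "\<xi> n \<omega> \<in> {1, -1}" using elim(1) False by (auto simp: Suc_le_eq odd_pos)
        ultimately show ?thesis using eq by auto
      qed
    qed
  qed
qed

lemma uniformly_integrable_stopped: "uniformly_integrable M Y"
  unfolding uniformly_integrable_def
proof (intro conjI allI impI)
  fix \<epsilon> :: real assume "\<epsilon> > 0"
  have "(\<integral>\<omega>. \<bar>Y n \<omega>\<bar> * indicator {\<omega>. \<bar>Y n \<omega>\<bar> > 2} \<omega> \<partial>M) = 0" for n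
  proof (rule integral_eq_zero_AE)
    show "AE \<omega> in M. \<bar>Y n \<omega>\<bar> * indicator {\<omega>. \<bar>Y n \<omega>\<bar> > 2} \<omega> = 0"
      using AE_stopped_bounded
    proof eventually_elim
      case (elim \<omega>)
      then have "\<bar>Y n \<omega>\<bar> \<le> 2" by (metis of_int_abs of_int_le_numeral_iff)
      then show ?case by simp
    qed
  qed
  then show "\<exists>K. \<forall>n. (\<integral>\<omega>. \<bar>Y n \<omega>\<bar> * indicator {\<omega>. \<bar>Y n \<omega>\<bar> > K} \<omega> \<partial>M) \<le> \<epsilon>"
    using \<open>\<epsilon> > 0\<close> by (intro exI[of _ 2]) simp
qed (rule integrable_stopped)

text \<open>Optional stopping, by dominated convergence with the constant bound 2.\<close>

lemma expectation_value_at: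
  "(\<integral>\<omega>. real_of_int (value_at (walk \<xi>) (embedding_time b) \<omega>) \<partial>M) = 0"
proof -
  have "(\<lambda>n. \<integral>\<omega>. Y n \<omega> \<partial>M) \<longlonglongrightarrow> (\<integral>\<omega>. real_of_int (value_at (walk \<xi>) (embedding_time b) \<omega>) \<partial>M)"
  proof (rule integral_dominated_convergence[where w = "\<lambda>_. 2"])
    show "AE \<omega> in M. (\<lambda>n. Y n \<omega>) \<longlonglongrightarrow> real_of_int (value_at (walk \<xi>) (embedding_time b) \<omega>)"
      using AE_embedding_time_finite
    proof eventually_elim
      case (elim \<omega>)
      then obtain m where m: "embedding_time b \<omega> = enat m" by auto
      have "\<forall>\<^sub>F n in sequentially. Y n \<omega> = real_of_int (value_at (walk \<xi>) (embedding_time b) \<omega>)"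
        using eventually_ge_at_top[of m] by eventually_elim (simp add: stopped_stopped m)
      then show ?case by (rule tendsto_eventually)
    qed
    show "AE \<omega> in M. norm (Y n \<omega>) \<le> 2" for n
      using AE_stopped_bounded
      by eventually_elim (metis of_int_abs of_int_le_numeral_iff real_norm_def)
  qed auto
  moreover have "(\<integral>\<omega>. Y n \<omega> \<partial>M) = 0" for n
  proof -
    have "(\<integral>\<omega>. Y n \<omega> \<partial>M) = (\<integral>\<omega>. indicator (space M) \<omega> * Y n \<omega> \<partial>M)"
      by (rule Bochner_Integration.integral_cong) auto
    also have "\<dots> = (\<integral>\<omega>. indicator (space M) \<omega> * Y 0 \<omega> \<partial>M)"
      by (rule integral_stopped) (use sets.top[of "\<F> 0"] in auto)
    finally show ?thesis by simp
  qed
  ultimately show ?thesis by (simp add: LIMSEQ_const_iff)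
qed

text \<open>Mean zero gives -2 and 2 equal mass, and together they carry
  \<open>1 - p\<close>.\<close>

lemma prob_value_nonzero:
  assumes "(\<lambda>n. real (b n) / 4 ^ n) sums p" "c \<in> {-2, 2}"
  shows "prob {\<omega> \<in> space M. value_at (walk \<xi>) (embedding_time b) \<omega> = c} = (1 - p) / 2"
proof -
  let ?V = "value_at (walk \<xi>) (embedding_time b)"
  define E where "E c = {\<omega> \<in> space M. ?V \<omega> = c}" for c
  have [measurable]: "E c \<in> sets M" for c unfolding E_def by measurable
  have ind: "integrable M (indicator (E c) :: 'a \<Rightarrow> real)" for c
    by (simp add: integrable_real_indicator emeasure_eq_measure)
  have "(\<integral>\<omega>. real_of_int (?V \<omega>) \<partial>M) = (\<integral>\<omega>. 2 * indicator (E 2) \<omega> - 2 * indicator (E (-2)) \<omega> \<partial>M)"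
  proof (rule integral_cong_AE)
    show "AE \<omega> in M. real_of_int (?V \<omega>) = 2 * indicator (E 2) \<omega> - 2 * indicator (E (-2)) \<omega>"
      using AE_value_at AE_space by eventually_elim (auto simp: E_def)
  qed auto
  then have eq: "prob (E 2) = prob (E (-2))" using ind by (simp add: expectation_value_at)
  have "prob (\<Union>c\<in>{-2, 0, 2}. E c) = prob (space M)"
    by (rule finite_measure_eq_AE) (use AE_value_at AE_space in \<open>auto simp: E_def elim: eventually_elim2\<close>)
  moreover have "prob (\<Union>c\<in>{-2, 0, 2}. E c) = (\<Sum>c\<in>{-2, 0, 2}. prob (E c))"
    by (rule finite_measure_finite_Union) (auto simp: disjoint_family_on_def E_def)
  ultimately have "prob (E (-2)) + prob (E 0) + prob (E 2) = 1" by (simp add: prob_space)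
  moreover have "prob (E 0) = p" using prob_value_zero[OF assms(1)] by (simp add: E_def)
  ultimately have "prob (E 2) = (1 - p) / 2" "prob (E (-2)) = (1 - p) / 2" using eq by (simp_all add: field_simps)
  then show ?thesis using assms(2) by (auto simp: E_def)
qed

end

lemma (in simple_symmetric_random_walk) kraft_values_UI_embeddable:
  assumes "pmf \<mu> 0 \<in> kraft_values" "set_pmf \<mu> \<subseteq> {-2, 0, 2}" "pmf \<mu> 2 = pmf \<mu> (-2)"
  shows "\<mu> \<in> UI_embeddable M (walk \<xi>)"
proof -
  obtain b :: "nat \<Rightarrow> nat" where kraft: "\<And>N. (\<Sum>n\<le>N. real (b n) / 2 ^ n) \<le> 1"
    and sums: "(\<lambda>n. real (b n) / 4 ^ n) sums pmf \<mu> 0"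
    using assms(1) by (auto simp: kraft_values_def)
  interpret kraft_embedding M \<xi> b by standard (rule kraft)
  let ?V = "value_at (walk \<xi>) (embedding_time b)"
  have "sum (pmf \<mu>) {-2, 0, 2} = 1" using assms(2) by (intro sum_pmf_eq_1) auto
  then have pmf2: "pmf \<mu> 2 = (1 - pmf \<mu> 0) / 2" "pmf \<mu> (-2) = (1 - pmf \<mu> 0) / 2"
    using assms(3) by simp_all
  have "prob {\<omega> \<in> space M. ?V \<omega> = c} = pmf \<mu> c" for c
  proof (cases "c \<in> {-2, 0, 2}")
    case True
    then consider "c = 0" | "c \<in> {-2, 2}" by auto
    then show ?thesis
    proof cases
      case 2
      have "prob {\<omega> \<in> space M. ?V \<omega> = c} = (1 - pmf \<mu> 0) / 2" by (rule prob_value_nonzero[OF sums 2])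
      then show ?thesis using 2 pmf2 by auto
    qed (simp add: prob_value_zero[OF sums])
  next
    case False
    have "prob {\<omega> \<in> space M. ?V \<omega> = c} = prob {}"
      by (rule finite_measure_eq_AE) (use AE_value_at False in \<open>auto elim: eventually_mono\<close>)
    moreover have "pmf \<mu> c = 0" using False assms(2) by (auto simp: set_pmf_iff)
    ultimately show ?thesis by simp
  qed
  then have "emeasure (distr M (count_space UNIV) ?V) {c} = emeasure (measure_pmf \<mu>) {c}" for c
    by (subst emeasure_distr) (auto simp: emeasure_pmf_single emeasure_eq_measure vimage_def Int_def conj_commute)
  then have "distr M (count_space UNIV) ?V = measure_pmf \<mu>"
    by (intro measure_eqI_countable[where A = UNIV]) auto
  then show ?thesis
    unfolding UI_embeddable_def
    using stopping AE_embedding_time_finite martingale_stopped uniformly_integrable_stopped by blast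
qed

section \<open>From Kraft values to measures\<close>

lemma centered_symmetric:
  assumes "\<mu> \<in> centered_measures" "set_pmf \<mu> \<subseteq> {-2, 0, 2}"
  shows "pmf \<mu> 2 = pmf \<mu> (-2)"
proof -
  have "measure_pmf.expectation \<mu> real_of_int = (\<Sum>c\<in>{-2, 0, 2}. real_of_int c * pmf \<mu> c)"
    using assms(2) by (intro integral_measure_pmf_real) auto
  then show ?thesis using assms(1) by (simp add: centered_measures_def)
qed

lemma (in simple_symmetric_random_walk) admissible_values_eq: "admissible_values M (walk \<xi>) = kraft_values"
proof
  show "admissible_values M (walk \<xi>) \<subseteq> kraft_values"
    unfolding admissible_values_def using UI_embeddable_kraft_values by blast
  show "kraft_values \<subseteq> admissible_values M (walk \<xi>)"
  proof
    fix p assume p: "p \<in> kraft_values"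
    then have p01: "0 \<le> p" "p \<le> 1" using kraft_values_unit by auto
    \<comment> \<open>The construction produces symmetric laws only, so the mass outside 0 is split
      evenly.\<close>
    define \<mu> where "\<mu> = bind_pmf (bernoulli_pmf p)
      (\<lambda>c. if c then return_pmf 0 else pmf_of_set {-2, 2 :: int})"
    have pmf: "pmf \<mu> c = p * indicator {0} c + (1 - p) * (indicator {-2, 2} c / 2)" for c
      using p01 by (simp add: \<mu>_def pmf_bind pmf_return pmf_of_set indicator_def)
    have "set_pmf \<mu> \<subseteq> {-2, 0, 2}"
      by (auto simp: \<mu>_def set_pmf_of_set split: if_splits)
    moreover have "pmf \<mu> 0 = p" "pmf \<mu> 2 = pmf \<mu> (-2)" by (simp_all add: pmf)
    ultimately show "p \<in> admissible_values M (walk \<xi>)"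
      using kraft_values_UI_embeddable[of \<mu>] p unfolding admissible_values_def by blast
  qed
qed

theorem theorem5:
  fixes M :: "'a measure" and \<xi> :: "nat \<Rightarrow> 'a \<Rightarrow> int"
  assumes "simple_symmetric_random_walk M \<xi>"
  shows
    "(\<forall>\<mu> p. \<mu> \<in> centered_measures \<and> set_pmf \<mu> \<subseteq> {-2, 0, 2} \<and> p = pmf \<mu> 0 \<longrightarrow>
        p = 1 - measure_pmf.prob \<mu> {-2, 2} \<and>
        (\<mu> \<in> UI_embeddable M (walk \<xi>) \<longleftrightarrow>
          (\<exists>a :: nat \<Rightarrow> int. (\<forall>n. a n \<in> {0, 1, 2, 3}) \<and>
             (\<lambda>n. real_of_int (a n) / 4 ^ n) sums p \<and>
             (\<forall>n. a n \<le> 2 ^ n - (\<Sum>i=1..n. 2 ^ i * a (n - i)))))) \<and>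
     (\<forall>a :: nat \<Rightarrow> int. (\<forall>n. a n \<in> {0, 1, 2, 3}) \<longrightarrow>
        (\<forall>n. a n \<le> 2 ^ n - (\<Sum>i=1..n. 2 ^ i * a (n - i))) \<longleftrightarrow>
        (\<Sum>i. real_of_int (a i) / 2 ^ i) \<le> 1) \<and>
     s_map \<in> closed_unit_subsets \<rightarrow> closed_unit_subsets \<and>
     admissible_values M (walk \<xi>) \<in> closed_unit_subsets \<and>
     s_map (admissible_values M (walk \<xi>)) = admissible_values M (walk \<xi>) \<and>
     (\<forall>A \<in> closed_unit_subsets. s_map A = A \<longrightarrow> A = admissible_values M (walk \<xi>))"
proof -
  interpret simple_symmetric_random_walk M \<xi> by (rule assms)
  have pmf_0: "pmf \<mu> 0 = 1 - measure_pmf.prob \<mu> {-2, 2}" if "set_pmf \<mu> \<subseteq> {-2, 0, 2}" for \<mu> :: "int pmf"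
  proof -
    have "sum (pmf \<mu>) {-2, 0, 2} = 1" using that by (intro sum_pmf_eq_1) auto
    then show ?thesis by (simp add: measure_measure_pmf_finite)
  qed
  have embed: "\<mu> \<in> UI_embeddable M (walk \<xi>) \<longleftrightarrow> pmf \<mu> 0 \<in> kraft_values"
    if "\<mu> \<in> centered_measures" "set_pmf \<mu> \<subseteq> {-2, 0, 2}" for \<mu>
    using UI_embeddable_kraft_values kraft_values_UI_embeddable centered_symmetric that by blast
  show ?thesis
    unfolding admissible_values_eq kraft_values_int_digits_iff[symmetric]
  proof (intro conjI allI impI Pi_I ballI)
    fix \<mu> p assume \<mu>: "\<mu> \<in> centered_measures \<and> set_pmf \<mu> \<subseteq> {-2, 0, 2} \<and> p = pmf \<mu> 0"
    then show "p = 1 - measure_pmf.prob \<mu> {-2, 2}" using pmf_0 by simp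
    show "\<mu> \<in> UI_embeddable M (walk \<xi>) \<longleftrightarrow> p \<in> kraft_values" using embed \<mu> by simp
  qed (fact kraft_partial_sums_suminf_iff s_map_closed_unit_subsets kraft_values_closed_unit_subsets
      s_map_kraft_values s_map_fixed_point_unique)+
qed


end
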